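(* Let $\rho=\rho_g(\mathbf{l},\mathbf{m};S)$ be an $n$-mode Gaussian state in $\Gamma(\mathbb{C}^n)$. Let the $2n\times 2n$ real symmetric covariance matrix $S$ have eigenvalues $\lambda_1\ge\lambda_2\ge\cdots\ge\lambda_{2n}$ with respective real orthonormal eigenvectors $\mathbf{b}_1,\dots,\mathbf{b}_{2n}$, and write $$\begin{pmatrix}\mathbf{l}\\ -\mathbf{m}\end{pmatrix}=\sum_{j=1}^{2n}\tau_j\,\mathbf{b}_j,\qquad \tau_j\in\mathbb{R}.$$ Put $\alpha_j=\dfrac{\lambda_j-\frac12}{\lambda_j+\frac12}$ for $1\le j\le 2n$. Then the probability generating function $G_N(x)=\mathrm{Tr}\,\rho\,x^N=\sum_{k\ge 0}\Pr(N=k)x^k$ of the distribution of the total number operator $N$ in the state $\rho$ is $$G_N(x)=\prod_{j=1}^{2n}\sqrt{\frac{1-\alpha_j}{1-\alpha_jx}}\;\exp\left[-\frac12\tau_j^2\,\frac{(1-x)(1-\alpha_j)}{1-\alpha_jx}\right],\qquad 0\le x<1.$$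
   Context: $\Gamma(\mathbb{C}^n)=\bigoplus_{r\ge0}(\mathbb{C}^n)^{\circledS r}$ is the boson (symmetric) Fock space over $\mathbb{C}^n$ (inner products are linear in the second variable). For $\mathbf{u}\in\mathbb{C}^n$ the exponential vector is $\mathbf{e}(\mathbf{u})=\bigoplus_{r\ge0}\mathbf{u}^{\otimes r}/\sqrt{r!}$. The Weyl operator $W(\mathbf{u})$ is the unitary operator on $\Gamma(\mathbb{C}^n)$ determined by $W(\mathbf{u})\mathbf{e}(\mathbf{v})=e^{-\frac12\|\mathbf{u}\|^2-\langle\mathbf{u}|\mathbf{v}\rangle}\mathbf{e}(\mathbf{u}+\mathbf{v})$ for all $\mathbf{v}\in\mathbb{C}^n$. A state is a positive operator of trace one. The $n$-mode Gaussian state $\rho_g(\mathbf{l},\mathbf{m};S)$, with $\mathbf{l},\mathbf{m}\in\mathbb{R}^n$ and $S$ a real symmetric $2n\times2n$ matrix satisfying $2S+iJ_{2n}\ge0$, $J_{2n}=\begin{bmatrix} 0 & -I_n \\ I_n & 0 \end{bmatrix}$, is the unique state $\rho$ with $$\mathrm{Tr}\,\rho W(\mathbf{x}+i\mathbf{y})=\exp\left[-i\sqrt2(\mathbf{l}^T\mathbf{x}-\mathbf{m}^T\mathbf{y})-\begin{pmatrix}\mathbf{x}\\ \mathbf{y}\end{pmatrix}^TS\begin{pmatrix}\mathbf{x}\\ \mathbf{y}\end{pmatrix}\right],\quad\mathbf{x},\mathbf{y}\in\mathbb{R}^n.$$ The total number operator $N$ is the self-adjoint operator acting as multiplication by $r$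 on the $r$-particle subspace $(\mathbb{C}^n)^{\circledS r}$, $r=0,1,2,\dots$ (equivalently $N=\sum_j a_j^\dagger a_j$); $\Pr(N=k)=\mathrm{Tr}\,\rho P_k$ with $P_k$ the projection onto the $k$-particle subspace. *)

theory Defs
  imports "HOL-Analysis.Analysis" "HOL-Library.Multiset"
begin

section \<open>The boson Fock space over \<open>\<complex>\<^sup>n\<close>\<close>

text \<open>
  With \<open>n = CARD('n)\<close>, a tensor in the \<open>r\<close>-fold tensor power of \<open>\<complex>\<^sup>n\<close> is identified with the
  family of its coordinates in the basis \<open>e\<^bsub>i1\<^esub> \<otimes> \<dots> \<otimes> e\<^bsub>ir\<^esub>\<close>, indexed by the lists
  \<open>[i1, \<dots>, ir]\<close> over \<open>'n\<close>. Lists of all lengths thus index the Hilbert space direct sum over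
  \<open>r \<ge> 0\<close> (whose elements are the square-summable families), and the \<open>r\<close>-particle component of a
  vector is its restriction to the lists of length \<open>r\<close>. A tensor is symmetric iff its coordinates
  are unchanged when the indices are rearranged, i.e. when the list is replaced by one with
  the same multiset of entries.
\<close>

typedef 'n fock =
  "{f :: 'n list \<Rightarrow> complex.
      (\<forall>xs ys. mset xs = mset ys \<longrightarrow> f xs = f ys) \<and>
      (\<lambda>xs. (cmod (f xs))\<^sup>2) summable_on UNIV}"
  by (rule exI[of _ "\<lambda>_. 0"]) auto

setup_lifting type_definition_fock

lemma fock_square_summable: "(\<lambda>xs. (cmod (Rep_fock f xs))\<^sup>2) summable_on UNIV"
  using Rep_fock[of f] by blast

lemma fock_symmetric: "mset xs = mset ys \<Longrightarrow> Rep_fock f xs = Rep_fock f ys"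
  using Rep_fock[of f] by blast

lemma square_summable_add:
  fixes f g :: "'a \<Rightarrow> complex"
  assumes "(\<lambda>x. (cmod (f x))\<^sup>2) summable_on A" "(\<lambda>x. (cmod (g x))\<^sup>2) summable_on A"
  shows "(\<lambda>x. (cmod (f x + g x))\<^sup>2) summable_on A"
proof -
  have "(\<lambda>x. 2 * ((cmod (f x))\<^sup>2 + (cmod (g x))\<^sup>2)) summable_on A"
    by (intro summable_on_cmult_right summable_on_add assms)
  moreover have "(cmod (f x + g x))\<^sup>2 \<le> 2 * ((cmod (f x))\<^sup>2 + (cmod (g x))\<^sup>2)" for x
  proof -
    have "(cmod (f x + g x))\<^sup>2 \<le> (cmod (f x) + cmod (g x))\<^sup>2"
      by (simp add: norm_triangle_ineq power_mono)
    also have "\<dots> \<le> 2 * ((cmod (f x))\<^sup>2 + (cmod (g x))\<^sup>2)"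
      using sum_squares_bound[of "cmod (f x)" "cmod (g x)"] by (simp add: power2_sum)
    finally show ?thesis by simp
  qed
  ultimately show ?thesis
    by (rule Infinite_Sum.summable_on_comparison_test) simp_all
qed

lemma square_summable_mult:
  fixes f c :: "'a \<Rightarrow> complex"
  assumes "(\<lambda>x. (cmod (f x))\<^sup>2) summable_on A" "\<And>x. x \<in> A \<Longrightarrow> cmod (c x) \<le> C"
  shows "(\<lambda>x. (cmod (c x * f x))\<^sup>2) summable_on A"
proof -
  have "(\<lambda>x. C\<^sup>2 * (cmod (f x))\<^sup>2) summable_on A"
    by (intro summable_on_cmult_right assms)
  moreover have "(cmod (c x * f x))\<^sup>2 \<le> C\<^sup>2 * (cmod (f x))\<^sup>2" if "x \<in> A" for x
    using power_mono[OF assms(2)[OF that], of 2]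
    by (simp add: norm_mult power_mult_distrib mult_right_mono)
  ultimately show ?thesis
    by (rule Infinite_Sum.summable_on_comparison_test) simp_all
qed

lift_definition fock_scale :: "complex \<Rightarrow> 'n fock \<Rightarrow> 'n fock"  (infixr "*\<^sub>C" 75)
  is "\<lambda>c f xs. c * f xs"
proof (elim conjE, intro conjI)
  fix c and f :: "'n list \<Rightarrow> complex"
  show "(\<lambda>xs. (cmod (c * f xs))\<^sup>2) summable_on UNIV" if "(\<lambda>xs. (cmod (f xs))\<^sup>2) summable_on UNIV"
    using that by (rule square_summable_mult) (rule order.refl)
qed metis

text \<open>The inner product is linear in the second argument.\<close>

definition fock_inner :: "'n fock \<Rightarrow> 'n fock \<Rightarrow> complex" where
  "fock_inner f g = (\<Sum>\<^sub>\<infinity>xs. cnj (Rep_fock f xs) * Rep_fock g xs)"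

instantiation fock :: (type) real_vector
begin

lift_definition zero_fock :: "'a fock" is "\<lambda>_. 0" by simp

lift_definition plus_fock :: "'a fock \<Rightarrow> 'a fock \<Rightarrow> 'a fock" is "\<lambda>f g xs. f xs + g xs"
proof (elim conjE, intro conjI)
  fix f g :: "'a list \<Rightarrow> complex"
  show "(\<lambda>xs. (cmod (f xs + g xs))\<^sup>2) summable_on UNIV"
    if "(\<lambda>xs. (cmod (f xs))\<^sup>2) summable_on UNIV" "(\<lambda>xs. (cmod (g xs))\<^sup>2) summable_on UNIV"
    using that by (rule square_summable_add)
qed metis

lift_definition uminus_fock :: "'a fock \<Rightarrow> 'a fock" is "\<lambda>f xs. - f xs"
proof (elim conjE, intro conjI)
  fix f :: "'a list \<Rightarrow> complex"
  show "(\<lambda>xs. (cmod (- f xs))\<^sup>2) summable_on UNIV" if "(\<lambda>xs. (cmod (f xs))\<^sup>2) summable_on UNIV"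
    using that by (simp only: norm_minus_cancel)
qed metis

definition minus_fock :: "'a fock \<Rightarrow> 'a fock \<Rightarrow> 'a fock" where
  "minus_fock f g = f + - g"

definition scaleR_fock :: "real \<Rightarrow> 'a fock \<Rightarrow> 'a fock" where
  "scaleR_fock r f = complex_of_real r *\<^sub>C f"

instance
  by standard
     (simp_all add: Rep_fock_inject[symmetric] fun_eq_iff minus_fock_def scaleR_fock_def
       zero_fock.rep_eq plus_fock.rep_eq uminus_fock.rep_eq fock_scale.rep_eq algebra_simps)

end

lemma fock_inner_summable:
  "(\<lambda>xs. cnj (Rep_fock f xs) * Rep_fock g xs) summable_on UNIV"
proof (rule abs_summable_summable, rule Infinite_Sum.abs_summable_product)
  show "(\<lambda>xs. norm (cnj (Rep_fock f xs) * cnj (Rep_fock f xs))) summable_on UNIV"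
    using fock_square_summable[of f] by (simp add: norm_mult power2_eq_square)
  show "(\<lambda>xs. norm (Rep_fock g xs * Rep_fock g xs)) summable_on UNIV"
    using fock_square_summable[of g] by (simp add: norm_mult power2_eq_square)
qed

lemma fock_inner_cnj: "cnj (fock_inner f g) = fock_inner g f"
  unfolding fock_inner_def by (simp flip: infsum_cnj add: mult.commute)

lemma fock_inner_add_right: "fock_inner f (g + h) = fock_inner f g + fock_inner f h"
  unfolding fock_inner_def plus_fock.rep_eq
  by (simp add: distrib_left infsum_add fock_inner_summable)

lemma fock_inner_scale_right: "fock_inner f (c *\<^sub>C g) = c * fock_inner f g"
  unfolding fock_inner_def fock_scale.rep_eq
  by (simp add: mult.left_commute infsum_cmult_right')

lemma fock_inner_self:
  "fock_inner f f = complex_of_real (\<Sum>\<^sub>\<infinity>xs. (cmod (Rep_fock f xs))\<^sup>2)"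
proof -
  have "fock_inner f f = (\<Sum>\<^sub>\<infinity>xs. complex_of_real ((cmod (Rep_fock f xs))\<^sup>2))"
    unfolding fock_inner_def by (simp add: complex_norm_square mult.commute del: of_real_power)
  also have "\<dots> = complex_of_real (\<Sum>\<^sub>\<infinity>xs. (cmod (Rep_fock f xs))\<^sup>2)"
    by (intro infsumI has_sum_of_real has_sum_infsum fock_square_summable)
  finally show ?thesis .
qed

instantiation fock :: (type) real_inner
begin

definition inner_fock :: "'a fock \<Rightarrow> 'a fock \<Rightarrow> real" where
  "inner_fock f g = Re (fock_inner f g)"

definition norm_fock :: "'a fock \<Rightarrow> real" where
  "norm_fock f = sqrt (inner f f)"

definition sgn_fock :: "'a fock \<Rightarrow> 'a fock" where
  "sgn_fock f = f /\<^sub>R norm f"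

definition dist_fock :: "'a fock \<Rightarrow> 'a fock \<Rightarrow> real" where
  "dist_fock f g = norm (f - g)"

definition uniformity_fock :: "('a fock \<times> 'a fock) filter" where
  "uniformity_fock = (INF e\<in>{0 <..}. principal {(f, g). dist f g < e})"

definition open_fock :: "'a fock set \<Rightarrow> bool" where
  "open_fock U \<longleftrightarrow> (\<forall>f\<in>U. \<forall>\<^sub>F (f', g) in uniformity. f' = f \<longrightarrow> g \<in> U)"

instance
proof
  fix f g h :: "'a fock" and r :: real and U :: "'a fock set"
  have comm: "inner f g = inner g f" for f g :: "'a fock"
    unfolding inner_fock_def fock_inner_cnj[of g f, symmetric] by simp
  show "inner f g = inner g f"
    by (rule comm)
  show "inner (f + g) h = inner f h + inner g h"
    unfolding comm[of _ h] by (simp add: inner_fock_def fock_inner_add_right)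
  show "inner (r *\<^sub>R f) g = r * inner f g"
    unfolding comm[of _ g] by (simp add: inner_fock_def scaleR_fock_def fock_inner_scale_right)
  show "0 \<le> inner f f"
    unfolding inner_fock_def fock_inner_self by (simp add: infsum_nonneg)
  show "inner f f = 0 \<longleftrightarrow> f = 0"
  proof
    assume "inner f f = 0"
    then have "(\<Sum>\<^sub>\<infinity>xs. (cmod (Rep_fock f xs))\<^sup>2) = 0"
      by (simp add: inner_fock_def fock_inner_self)
    then have "(cmod (Rep_fock f xs))\<^sup>2 = 0" for xs
      using nonneg_infsum_le_0D[of "\<lambda>xs. (cmod (Rep_fock f xs))\<^sup>2" UNIV xs]
        fock_square_summable[of f] by simp
    then show "f = 0"
      by (intro Rep_fock_inject[THEN iffD1] ext) (simp add: zero_fock.rep_eq)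
  qed (simp add: inner_fock_def fock_inner_def zero_fock.rep_eq)
qed (simp_all add: norm_fock_def sgn_fock_def dist_fock_def uniformity_fock_def open_fock_def)

end

section \<open>Exponential vectors\<close>

definition cvec_inner :: "complex ^ 'n \<Rightarrow> complex ^ 'n \<Rightarrow> complex" where
  "cvec_inner u v = (\<Sum>i\<in>UNIV. cnj (u $ i) * v $ i)"

lemma prod_list_map_mset:
  fixes f :: "'a \<Rightarrow> 'b::comm_monoid_mult"
  shows "mset xs = mset ys \<Longrightarrow> (\<Prod>i\<leftarrow>xs. f i) = (\<Prod>i\<leftarrow>ys. f i)"
  by (metis mset_map prod_mset_prod_list)

lemma lists_length_Suc: "{xs :: 'a list. length xs = Suc r} = (\<lambda>(i, xs). i # xs) ` (UNIV \<times> {xs. length xs = r})"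
  by (auto simp: image_iff length_Suc_conv)

lemma sum_lists_length_prod_list:
  fixes f :: "'a::finite \<Rightarrow> real"
  shows "finite {xs :: 'a list. length xs = r} \<and>
    (\<Sum>xs | length xs = r. \<Prod>i\<leftarrow>xs. f i) = (\<Sum>i\<in>UNIV. f i) ^ r"
proof (induction r)
  case (Suc r)
  have inj: "inj_on (\<lambda>(i :: 'a, xs). i # xs) (UNIV \<times> {xs. length xs = r})"
    by (auto simp: inj_on_def)
  show ?case
    using Suc unfolding lists_length_Suc sum.reindex[OF inj]
    by (simp add: case_prod_unfold comp_def sum.cartesian_product' sum_product
        flip: sum_distrib_left sum_distrib_right)
qed simp

text \<open>The \<open>r\<close>-particle component of \<open>exp_vec u\<close> is the \<open>r\<close>-th tensor power of \<open>u\<close> divided by \<open>sqrt r!\<close>.\<close>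

lift_definition exp_vec :: "complex ^ 'n \<Rightarrow> 'n::finite fock"
  is "\<lambda>u xs. (\<Prod>i\<leftarrow>xs. u $ i) / complex_of_real (sqrt (fact (length xs)))"
proof (intro conjI allI impI)
  fix u :: "complex ^ 'n" and xs ys :: "'n list"
  assume "mset xs = mset ys"
  then show "(\<Prod>i\<leftarrow>xs. u $ i) / complex_of_real (sqrt (fact (length xs))) =
      (\<Prod>i\<leftarrow>ys. u $ i) / complex_of_real (sqrt (fact (length ys)))"
    by (simp only: prod_list_map_mset[of xs ys] mset_eq_length[of xs ys])
next
  fix u :: "complex ^ 'n"
  let ?g = "\<lambda>xs :: 'n list. (\<Prod>i\<leftarrow>xs. (cmod (u $ i))\<^sup>2) / fact (length xs)"
  let ?s = "\<Sum>i\<in>UNIV. (cmod (u $ i))\<^sup>2"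
  have eq: "(cmod ((\<Prod>i\<leftarrow>xs. u $ i) / complex_of_real (sqrt (fact (length xs)))))\<^sup>2 = ?g xs"
    for xs :: "'n list"
  proof -
    have "(cmod (\<Prod>i\<leftarrow>ys. u $ i))\<^sup>2 = (\<Prod>i\<leftarrow>ys. (cmod (u $ i))\<^sup>2)" for ys
      by (induction ys) (simp_all add: norm_mult power_mult_distrib)
    then show ?thesis by (simp add: norm_divide power_divide)
  qed
  have nonneg: "0 \<le> ?g xs" for xs
    by (intro divide_nonneg_nonneg prod_list_nonneg) auto
  have "sum ?g F \<le> exp ?s" if fin: "finite F" for F
  proof -
    obtain R where R: "\<And>xs. xs \<in> F \<Longrightarrow> length xs < R"
      using finite_nat_set_iff_bounded[THEN iffD1, OF finite_imageI[OF fin, of length]] by blast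
    have "sum ?g F \<le> sum ?g (\<Union>r\<in>{..<R}. {xs. length xs = r})"
      using R sum_lists_length_prod_list[where 'a = 'n] nonneg by (intro sum_mono2) auto
    also have "\<dots> = (\<Sum>r<R. \<Sum>xs | length xs = r. ?g xs)"
      using sum_lists_length_prod_list[where 'a = 'n] by (intro sum.UNION_disjoint) auto
    also have "\<dots> = (\<Sum>r<R. ?s ^ r / fact r)"
      using sum_lists_length_prod_list[of _ "\<lambda>i. (cmod (u $ i))\<^sup>2"]
      by (intro sum.cong refl) (simp flip: sum_divide_distrib)
    also have "\<dots> \<le> exp ?s"
      unfolding exp_def using summable_exp[of ?s]
      by (intro order.trans[OF sum_le_suminf[of "\<lambda>r. ?s ^ r / fact r" "{..<R}"]])
         (auto simp: divide_inverse mult.commute scaleR_conv_of_real sum_nonneg)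
    finally show ?thesis .
  qed
  then have "?g summable_on UNIV"
    by (intro nonneg_bdd_above_summable_on nonneg bdd_aboveI2[where M = "exp ?s"]) auto
  then show "(\<lambda>xs. (cmod ((\<Prod>i\<leftarrow>xs. u $ i) / complex_of_real (sqrt (fact (length xs)))))\<^sup>2)
      summable_on UNIV"
    by (simp only: eq)
qed

section \<open>Bounded operators, trace and states\<close>

definition bounded_op :: "('n fock \<Rightarrow> 'n fock) \<Rightarrow> bool" where
  "bounded_op A \<longleftrightarrow> bounded_linear A \<and> (\<forall>c f. A (c *\<^sub>C f) = c *\<^sub>C A f)"

definition unitary_op :: "('n fock \<Rightarrow> 'n fock) \<Rightarrow> bool" where
  "unitary_op U \<longleftrightarrow>
     bounded_op U \<and> surj U \<and> (\<forall>f g. fock_inner (U f) (U g) = fock_inner f g)"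

definition positive_op :: "('n fock \<Rightarrow> 'n fock) \<Rightarrow> bool" where
  "positive_op A \<longleftrightarrow>
     bounded_op A \<and> (\<forall>f. fock_inner f (A f) \<in> \<real> \<and> 0 \<le> Re (fock_inner f (A f)))"

definition orthonormal_basis :: "'n fock set \<Rightarrow> bool" where
  "orthonormal_basis B \<longleftrightarrow>
     (\<forall>e\<in>B. \<forall>e'\<in>B. fock_inner e e' = (if e = e' then 1 else 0)) \<and>
     (\<forall>f. (\<forall>e\<in>B. fock_inner e f = 0) \<longrightarrow> f = 0)"

text \<open>
  A bounded operator is trace class iff its diagonal sum converges (unconditionally) in every
  orthonormal basis; the sum then does not depend on the basis. So \<open>has_trace A t\<close> says
  that \<open>A\<close> is trace class with trace \<open>t\<close>.
\<close>

definition has_trace :: "('n fock \<Rightarrow> 'n fock) \<Rightarrow> complex \<Rightarrow> bool" where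
  "has_trace A t \<longleftrightarrow> bounded_op A \<and>
     (\<forall>B. orthonormal_basis B \<longrightarrow> ((\<lambda>e. fock_inner e (A e)) has_sum t) B)"

definition fock_trace :: "('n fock \<Rightarrow> 'n fock) \<Rightarrow> complex" where
  "fock_trace A = (THE t. has_trace A t)"

definition state :: "('n fock \<Rightarrow> 'n fock) \<Rightarrow> bool" where
  "state \<rho> \<longleftrightarrow> positive_op \<rho> \<and> has_trace \<rho> 1"

section \<open>Weyl operators and Gaussian states\<close>

definition weyl :: "complex ^ 'n \<Rightarrow> 'n::finite fock \<Rightarrow> 'n fock" where
  "weyl u = (THE W. unitary_op W \<and>
     (\<forall>v. W (exp_vec v) = exp (- of_real ((norm u)\<^sup>2) / 2 - cvec_inner u v) *\<^sub>C exp_vec (u + v)))"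

text \<open>Vectors and matrices of size \<open>2n\<close> in \<open>n\<close>-blocks are indexed by the sum type \<open>'n + 'n\<close>.\<close>

definition block_vec :: "'a ^ 'n \<Rightarrow> 'a ^ 'n \<Rightarrow> 'a ^ ('n + 'n)" where
  "block_vec x y = (\<chi> i. case i of Inl j \<Rightarrow> x $ j | Inr j \<Rightarrow> y $ j)"

definition J_mat :: "real ^ ('n + 'n) ^ ('n::finite + 'n)" where
  "J_mat = (\<chi> i j. case (i, j) of
       (Inl a, Inr b) \<Rightarrow> if a = b then - 1 else 0
     | (Inr a, Inl b) \<Rightarrow> if a = b then 1 else 0
     | _ \<Rightarrow> 0)"

definition psd_mat :: "complex ^ 'm ^ 'm \<Rightarrow> bool" where
  "psd_mat M \<longleftrightarrow> (\<forall>z. cvec_inner z (M *v z) \<in> \<real> \<and> 0 \<le> Re (cvec_inner z (M *v z)))"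

text \<open>\<open>gaussian_state l m S \<rho>\<close>: the parameters are admissible and \<open>\<rho>\<close> is the state \<open>\<rho>\<^sub>g(l, m; S)\<close>.\<close>

definition gaussian_state ::
  "real ^ 'n \<Rightarrow> real ^ 'n \<Rightarrow> real ^ ('n + 'n) ^ ('n + 'n) \<Rightarrow> ('n::finite fock \<Rightarrow> 'n fock) \<Rightarrow> bool"
where
  "gaussian_state l m S \<rho> \<longleftrightarrow>
     transpose S = S \<and>
     psd_mat (\<chi> i j. complex_of_real (2 * S $ i $ j) + \<i> * complex_of_real (J_mat $ i $ j)) \<and>
     state \<rho> \<and>
     (\<forall>x y. has_trace (\<rho> \<circ> weyl (\<chi> i. Complex (x $ i) (y $ i)))
        (exp (- \<i> * of_real (sqrt 2 * (l \<bullet> x - m \<bullet> y))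
              - of_real (block_vec x y \<bullet> (S *v block_vec x y)))))"

section \<open>The total number operator\<close>

lift_definition particle_proj :: "nat \<Rightarrow> 'n fock \<Rightarrow> 'n fock"
  is "\<lambda>k f xs. if length xs = k then f xs else 0"
proof (intro conjI allI impI)
  fix k and f :: "'n list \<Rightarrow> complex" and xs ys :: "'n list"
  assume "(\<forall>xs ys. mset xs = mset ys \<longrightarrow> f xs = f ys) \<and> (\<lambda>xs. (cmod (f xs))\<^sup>2) summable_on UNIV"
    and eq: "mset xs = mset ys"
  then have "f xs = f ys" by blast
  then show "(if length xs = k then f xs else 0) = (if length ys = k then f ys else 0)"
    by (simp add: mset_eq_length[OF eq])
next
  fix k and f :: "'n list \<Rightarrow> complex"
  assume "(\<forall>xs ys. mset xs = mset ys \<longrightarrow> f xs = f ys) \<and> (\<lambda>xs. (cmod (f xs))\<^sup>2) summable_on UNIV"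
  then have "(\<lambda>xs. (cmod (f xs))\<^sup>2) summable_on UNIV" by blast
  then show "(\<lambda>xs. (cmod (if length xs = k then f xs else 0))\<^sup>2) summable_on UNIV"
    by (rule Infinite_Sum.summable_on_comparison_test) auto
qed

definition number_prob :: "('n fock \<Rightarrow> 'n fock) \<Rightarrow> nat \<Rightarrow> real" where
  "number_prob \<rho> k = Re (fock_trace (\<rho> \<circ> particle_proj k))"

text \<open>
  \<open>number_power x\<close> is \<open>x\<^sup>N\<close>, for \<open>\<bar>x\<bar> \<le> 1\<close>: the total number operator \<open>N\<close> acts as multiplication
  by \<open>r\<close> on the \<open>r\<close>-particle subspace, so \<open>x\<^sup>N\<close> acts there as multiplication by \<open>x\<^sup>r\<close>
  (with \<open>0\<^sup>0 = 1\<close>).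
\<close>

definition number_power :: "real \<Rightarrow> 'n fock \<Rightarrow> 'n fock" where
  "number_power x f = Abs_fock (\<lambda>xs. complex_of_real x ^ length xs * Rep_fock f xs)"

lemma Rep_number_power:
  assumes "\<bar>x\<bar> \<le> 1"
  shows "Rep_fock (number_power x f) xs = complex_of_real x ^ length xs * Rep_fock f xs"
proof -
  have "(\<lambda>xs. (cmod (complex_of_real x ^ length xs * Rep_fock f xs))\<^sup>2) summable_on UNIV"
    by (rule square_summable_mult[where C = 1])
       (use assms in \<open>auto simp: fock_square_summable norm_power power_le_one\<close>)
  moreover have "complex_of_real x ^ length xs * Rep_fock f xs = complex_of_real x ^ length ys * Rep_fock f ys"
    if "mset xs = mset ys" for xs ys
    using mset_eq_length[OF that] fock_symmetric[OF that, of f] by simp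
  ultimately show ?thesis
    unfolding number_power_def by (subst Abs_fock_inverse) blast+
qed

definition number_pgf :: "('n fock \<Rightarrow> 'n fock) \<Rightarrow> real \<Rightarrow> real" where
  "number_pgf \<rho> x = (\<Sum>k. number_prob \<rho> k * x ^ k)"

end

theory Submission
  imports Defs "HOL-Probability.Characteristic_Functions"
begin

text \<open>
  For \<open>0 \<le> x < 1\<close> the operator \<open>x\<^sup>N\<close> is a Gaussian mixture of Weyl operators: weakly,
  \<open>(\<pi> (1 - x))\<^sup>n x\<^sup>N = \<integral> exp (- \<kappa> \<bar>z\<bar>\<^sup>2) W(z) dz\<close> with \<open>\<kappa> = 1 / (1 - x) - 1 / 2\<close>. Between
  exponential vectors this is a Gaussian integral, and it extends because exponential vectors are
  total. Taking the trace against \<open>\<rho>\<close>, the exchange with the integral being justified by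
  \<open>2 \<bar>\<langle>f, \<rho> g\<rangle>\<bar> \<le> \<langle>f, \<rho> f\<rangle> + \<langle>g, \<rho> g\<rangle>\<close>, turns the generating function into the integral of
  \<open>exp (- \<kappa> \<bar>z\<bar>\<^sup>2)\<close> times the characteristic function of \<open>\<rho>\<close>. In an orthonormal eigenbasis of
  the covariance matrix that integral is a product of one-dimensional Gaussian integrals.
\<close>

section \<open>Real Hilbert spaces\<close>

text \<open>Traces are given only as diagonal sums, equal in all orthonormal bases, so nothing may
  be moved under a trace for free. Two facts stand in for a trace class theory. The operators
  \<open>number_power x\<close> and \<open>particle_proj k\<close> are diagonal in the occupation
  number basis with absolutely summable entries (for 0 \<le> x < 1), which makes the diagonal sums
  of their products with \<open>\<rho>\<close> independent of the basis. For
  \<open>\<rho> \<circ> weyl u\<close> the trace exists because \<open>gaussian_state\<close> says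
  so; what has to be added is a bound on finite partial sums that is uniform in u, so that the
  Gaussian weight itself is a dominating function. Since \<open>weyl\<close> is a definite
  description, existence and uniqueness have to be proved. These, and every passage from exponential
  vectors to all vectors, rest on totality, mostly through one fact: a closed subspace that contains
  a total family is the whole space. This is done over the reals; the complex structure is recovered
  by putting all complex multiples into the family. The exponent of the integral in direction j is
  \<kappa> + \<open>lam j\<close> = (1 + (\<open>lam j\<close> - 1/2)(1-x)) / (1-x), and this is how
  \<open>\<alpha> j\<close> enters.\<close>

lemma closed_subspace_attains_distance:
  fixes X :: "'a::{real_inner,complete_space} set"
  assumes "subspace X" "closed X"
  obtains y where "y \<in> X" "\<And>z. z \<in> X \<Longrightarrow> norm (x - y) \<le> norm (x - z)"
proof -
  define d where "d = (INF z\<in>X. norm (x - z))"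
  have ne: "X \<noteq> {}" using subspace_0[OF assms(1)] by auto
  have bdd: "bdd_below ((\<lambda>z. norm (x - z)) ` X)" by (intro bdd_belowI2[of _ 0]) auto
  have d_le: "d \<le> norm (x - z)" if "z \<in> X" for z
    unfolding d_def using bdd that by (rule cINF_lower)
  have d0: "0 \<le> d" unfolding d_def using ne by (intro cINF_greatest) auto
  have "\<exists>z\<in>X. norm (x - z) < d + 1 / real (Suc n)" for n
    using cINF_less_iff[OF ne bdd, of "d + 1 / real (Suc n)"] unfolding d_def by simp
  then obtain y where yX: "\<And>n. y n \<in> X" and yd: "\<And>n. norm (x - y n) < d + 1 / real (Suc n)"
    by metis
  have "(\<lambda>n. (d + 1 / real (Suc n))\<^sup>2) \<longlonglongrightarrow> (d + 0)\<^sup>2"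
    by (intro tendsto_intros LIMSEQ_Suc lim_1_over_n)
  then have sq: "(\<lambda>n. (d + 1 / real (Suc n))\<^sup>2) \<longlonglongrightarrow> d\<^sup>2" by simp
  \<comment> \<open>Parallelogram law: the midpoint of two points of X lies in X, hence is no closer
    to x than d. This forces a minimizing sequence to be Cauchy.\<close>
  have para: "(norm (y m - y n))\<^sup>2 \<le> 2 * (norm (x - y m))\<^sup>2 + 2 * (norm (x - y n))\<^sup>2 - 4 * d\<^sup>2" for m n
  proof -
    have "(1/2) *\<^sub>R (y m + y n) \<in> X"
      using assms(1) yX by (intro subspace_scale subspace_add)
    from d_le[OF this] have "d\<^sup>2 \<le> (norm (x - (1/2) *\<^sub>R (y m + y n)))\<^sup>2"
      using d0 by (intro power_mono)
    then show ?thesis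
      by (simp add: power2_norm_eq_inner inner_diff_left inner_diff_right inner_add_left inner_add_right
         inner_commute field_simps)
  qed
  have "Cauchy y"
  proof (rule metric_CauchyI)
    fix e :: real assume e: "0 < e"
    have "\<forall>\<^sub>F n in sequentially. (d + 1 / real (Suc n))\<^sup>2 < d\<^sup>2 + e\<^sup>2 / 4"
      using e by (intro order_tendstoD(2)[OF sq]) auto
    then obtain M where M: "\<And>n. n \<ge> M \<Longrightarrow> (d + 1 / real (Suc n))\<^sup>2 < d\<^sup>2 + e\<^sup>2 / 4"
      unfolding eventually_sequentially by auto
    have b: "(norm (x - y n))\<^sup>2 < d\<^sup>2 + e\<^sup>2 / 4" if "n \<ge> M" for n
    proof -
      have "(norm (x - y n))\<^sup>2 \<le> (d + 1 / real (Suc n))\<^sup>2"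
        using yd[of n] by (intro power_mono) auto
      then show ?thesis using M[OF that] by linarith
    qed
    have "dist (y m) (y n) < e" if "m \<ge> M" "n \<ge> M" for m n
    proof -
      have "(norm (y m - y n))\<^sup>2 < e\<^sup>2"
        using para[of m n] b[OF that(1)] b[OF that(2)] by linarith
      then show ?thesis using e by (simp add: dist_norm power2_less_imp_less)
    qed
    then show "\<exists>M. \<forall>m\<ge>M. \<forall>n\<ge>M. dist (y m) (y n) < e" by blast
  qed
  then obtain l where l: "y \<longlonglongrightarrow> l" using Cauchy_convergent convergent_def by blast
  have "l \<in> X" using assms(2) yX l closed_sequentially by blast
  moreover have "norm (x - l) \<le> d"
  proof (rule LIMSEQ_le)
    show "(\<lambda>n. norm (x - y n)) \<longlonglongrightarrow> norm (x - l)" by (intro tendsto_intros l)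
    have "(\<lambda>n. d + 1 / real (Suc n)) \<longlonglongrightarrow> d + 0"
      by (intro tendsto_intros LIMSEQ_Suc lim_1_over_n)
    then show "(\<lambda>n. d + 1 / real (Suc n)) \<longlonglongrightarrow> d" by simp
    show "\<exists>N. \<forall>n\<ge>N. norm (x - y n) \<le> d + 1 / real (Suc n)" using yd less_imp_le by blast
  qed
  ultimately show ?thesis using that d_le order.trans by blast
qed

text \<open>The residual at a nearest point is orthogonal to X, so it vanishes by totality. All
  density arguments below have this form: the vectors satisfying an identity form a closed
  subspace.\<close>

lemma closed_subspace_eq_UNIV:
  fixes X :: "'a::{real_inner,complete_space} set"
  assumes sub: "subspace X" and "closed X"
    and total: "\<And>x. (\<And>y. y \<in> X \<Longrightarrow> inner x y = 0) \<Longrightarrow> x = 0"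
  shows "X = UNIV"
proof -
  have "x \<in> X" for x
  proof -
    obtain y where y: "y \<in> X" and min: "\<And>z. z \<in> X \<Longrightarrow> norm (x - y) \<le> norm (x - z)"
      using closed_subspace_attains_distance[OF assms(1,2)] by metis
    have "inner (x - y) z = 0" if z: "z \<in> X" for z
    proof (rule ccontr)
      assume nz: "inner (x - y) z \<noteq> 0"
      then have zz: "inner z z > 0" by auto
      \<comment> \<open>The minimizer of the distance from x - y to the line through z; moving y by
        it would decrease the distance strictly.\<close>
      define t where "t = inner (x - y) z / inner z z"
      have "y + t *\<^sub>R z \<in> X" using sub y z by (intro subspace_add subspace_scale)
      from min[OF this] have "(norm (x - y))\<^sup>2 \<le> (norm (x - (y + t *\<^sub>R z)))\<^sup>2"
        by (intro power_mono) auto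
      also have "\<dots> = (norm ((x - y) - t *\<^sub>R z))\<^sup>2" by (simp add: algebra_simps)
      also have "\<dots> = (norm (x - y))\<^sup>2 - 2 * t * inner (x - y) z + t * t * inner z z"
        unfolding power2_norm_eq_inner
        by (simp add: inner_diff_left[of "x - y"] inner_diff_right[of _ "x - y"] inner_commute[of z "x - y"])
          (simp add: algebra_simps)
      also have "\<dots> = (norm (x - y))\<^sup>2 - (inner (x - y) z)\<^sup>2 / inner z z"
        using zz by (simp add: t_def power2_eq_square field_simps)
      finally show False using nz zz by (simp add: field_simps)
    qed
    then have "x - y = 0" by (rule total)
    then show ?thesis using y by simp
  qed
  then show ?thesis by blast
qed

text \<open>The kernel of F - G is closed and contains the family. Totality refers to the real inner
  product, so in applications the family contains all complex multiples.\<close>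

lemma bounded_linear_eq_on_total:
  fixes F G :: "'a::{real_inner,complete_space} \<Rightarrow> 'b::real_normed_vector"
  assumes F: "bounded_linear F" and G: "bounded_linear G" and eq: "\<And>i. F (a i) = G (a i)"
    and total: "\<And>x. (\<And>i. inner x (a i) = 0) \<Longrightarrow> x = 0"
  shows "F = G"
proof -
  have D: "bounded_linear (\<lambda>x. F x - G x)" using F G by (rule bounded_linear_sub)
  have "{x. F x - G x = 0} = UNIV"
  proof (rule closed_subspace_eq_UNIV)
    show "subspace {x. F x - G x = 0}"
      using linear_subspace_kernel[OF bounded_linear.linear[OF D]] .
    show "closed {x. F x - G x = 0}"
      by (intro closed_Collect_eq linear_continuous_on D continuous_on_const)
    show "x = 0" if "\<And>y. y \<in> {x. F x - G x = 0} \<Longrightarrow> inner x y = 0" for x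
      using that eq by (intro total) auto
  qed
  then show ?thesis by (auto simp: fun_eq_iff)
qed

lemma subspace_closure:
  fixes X :: "'a::real_normed_vector set"
  assumes "subspace X" shows "subspace (closure X)"
proof (rule subspaceI)
  show "0 \<in> closure X" using subspace_0[OF assms] closure_subset by blast
  show "x + y \<in> closure X" if xy: "x \<in> closure X" "y \<in> closure X" for x y
  proof -
    obtain f g where "\<And>n. f n \<in> X" "f \<longlonglongrightarrow> x" "\<And>n. g n \<in> X" "g \<longlonglongrightarrow> y"
      using xy unfolding closure_sequential by metis
    then show ?thesis unfolding closure_sequential
      using assms by (intro exI[of _ "\<lambda>n. f n + g n"]) (auto intro: tendsto_intros subspace_add)
  qed
  show "c *\<^sub>R x \<in> closure X" if "x \<in> closure X" for c x
  proof -
    obtain f where "\<And>n. f n \<in> X" "f \<longlonglongrightarrow> x" using \<open>x \<in> closure X\<close> unfolding closure_sequential by metis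
    then show ?thesis unfolding closure_sequential
      using assms by (intro exI[of _ "\<lambda>n. c *\<^sub>R f n"]) (auto intro: tendsto_intros subspace_scale)
  qed
qed

text \<open>The graph of the extension is the closed linear span of the pairs \<open>(a i, a' i)\<close>.\<close>

lemma isometric_extension:
  fixes a :: "'i \<Rightarrow> 'a::{real_inner,complete_space}" and a' :: "'i \<Rightarrow> 'b::{real_inner,complete_space}"
  assumes iso: "\<And>i j. inner (a i) (a j) = inner (a' i) (a' j)"
    and total: "\<And>x. (\<And>i. inner x (a i) = 0) \<Longrightarrow> x = 0"
    and total': "\<And>x. (\<And>i. inner x (a' i) = 0) \<Longrightarrow> x = 0"
  obtains W where "bounded_linear W" "surj W" "\<And>x y. inner (W x) (W y) = inner x y" "\<And>i. W (a i) = a' i"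
proof -
  define G where "G = closure (span (range (\<lambda>i. (a i, a' i))))"
  have subG: "subspace G" unfolding G_def by (intro subspace_closure subspace_span)
  have closedG: "closed G" unfolding G_def by simp
  have aG: "(a i, a' i) \<in> G" for i
    unfolding G_def by (rule subsetD[OF closure_subset], rule span_base) auto
  have cont: "continuous_on UNIV (\<lambda>p :: 'a \<times> 'b. inner (fst p) (fst q) - inner (snd p) (snd q))" for q
    by (intro continuous_intros)
  have lin: "linear (\<lambda>p :: 'a \<times> 'b. inner (fst p) (fst q) - inner (snd p) (snd q))" for q
    by (rule linearI) (auto simp: inner_add_left algebra_simps)
  \<comment> \<open>A relation linear in p and closed passes from the generators to G. Using it once
    for each argument makes the pairing agree on all of G.\<close>
  have extend: "G \<subseteq> {p. inner (fst p) (fst q) - inner (snd p) (snd q) = 0}"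
    if "\<And>i. inner (a i) (fst q) - inner (a' i) (snd q) = 0" for q
    unfolding G_def
  proof (rule closure_minimal)
    show "closed {p. inner (fst p) (fst q) - inner (snd p) (snd q) = 0}"
      by (intro closed_Collect_eq cont continuous_on_const)
    show "span (range (\<lambda>i. (a i, a' i))) \<subseteq> {p. inner (fst p) (fst q) - inner (snd p) (snd q) = 0}"
      using that by (intro span_minimal linear_subspace_kernel[OF lin]) auto
  qed
  have isoG: "inner (fst p) (fst q) = inner (snd p) (snd q)" if p: "p \<in> G" and q: "q \<in> G" for p q
  proof -
    have "inner (fst q) (a i) - inner (snd q) (a' i) = 0" for i
      using extend[of "(a i, a' i)"] q iso by auto
    then show ?thesis using extend[of q] p by (auto simp: inner_commute)
  qed
  have isoD: "dist (fst p) (fst q) = dist (snd p) (snd q)" if "p \<in> G" "q \<in> G" for p q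
    using isoG[of "p - q" "p - q"] subspace_diff[OF subG that] by (simp add: dist_norm norm_eq_sqrt_inner)
  \<comment> \<open>By \<open>isoD\<close> a sequence in G that is Cauchy in one coordinate is
    Cauchy in the other, so it converges in G. Hence both projections of G are closed.\<close>
  have lim: "\<exists>p\<in>G. (\<lambda>n. s n) \<longlonglongrightarrow> p" if s: "\<And>n. s n \<in> G" and C: "Cauchy (\<lambda>n. fst (s n)) \<or> Cauchy (\<lambda>n. snd (s n))" for s
  proof -
    have "Cauchy (\<lambda>n. fst (s n)) \<longleftrightarrow> Cauchy (\<lambda>n. snd (s n))"
      by (simp only: Cauchy_def isoD[OF s s])
    with C have "convergent (\<lambda>n. fst (s n))" "convergent (\<lambda>n. snd (s n))"
      by (auto intro: Cauchy_convergent)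
    then obtain x y where "(\<lambda>n. fst (s n)) \<longlonglongrightarrow> x" "(\<lambda>n. snd (s n)) \<longlonglongrightarrow> y"
      unfolding convergent_def by blast
    then have "(\<lambda>n. (fst (s n), snd (s n))) \<longlonglongrightarrow> (x, y)" by (rule tendsto_Pair)
    then have "s \<longlonglongrightarrow> (x, y)" by simp
    then show ?thesis using closedG s closed_sequentially by blast
  qed
  have fst_UNIV: "fst ` G = UNIV"
  proof (rule closed_subspace_eq_UNIV)
    show "subspace (fst ` G)" by (rule linear_subspace_image[OF linear_fst subG])
    show "closed (fst ` G)" unfolding closed_sequential_limits
    proof safe
      fix f l assume f: "\<forall>n. f n \<in> fst ` G" "f \<longlonglongrightarrow> l"
      then have "\<forall>n. \<exists>p. p \<in> G \<and> f n = fst p" by blast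
      then obtain s where s: "\<And>n. s n \<in> G" "\<And>n. f n = fst (s n)" by metis
      from s(2) have fs: "f = (\<lambda>n. fst (s n))" by (rule ext)
      obtain p where p: "p \<in> G" "s \<longlonglongrightarrow> p"
        using lim[of s, OF s(1)] LIMSEQ_imp_Cauchy[OF f(2)] unfolding fs by blast
      have "f \<longlonglongrightarrow> fst p" unfolding fs using p(2) by (rule tendsto_fst)
      then have "l = fst p" using f(2) LIMSEQ_unique by blast
      then show "l \<in> fst ` G" using p(1) by blast
    qed
    show "x = 0" if "\<And>y. y \<in> fst ` G \<Longrightarrow> inner x y = 0" for x
      using that aG by (intro total) force
  qed
  have snd_UNIV: "snd ` G = UNIV"
  proof (rule closed_subspace_eq_UNIV)
    show "subspace (snd ` G)" by (rule linear_subspace_image[OF linear_snd subG])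
    show "closed (snd ` G)" unfolding closed_sequential_limits
    proof safe
      fix f l assume f: "\<forall>n. f n \<in> snd ` G" "f \<longlonglongrightarrow> l"
      then have "\<forall>n. \<exists>p. p \<in> G \<and> f n = snd p" by blast
      then obtain s where s: "\<And>n. s n \<in> G" "\<And>n. f n = snd (s n)" by metis
      from s(2) have fs: "f = (\<lambda>n. snd (s n))" by (rule ext)
      obtain p where p: "p \<in> G" "s \<longlonglongrightarrow> p"
        using lim[of s, OF s(1)] LIMSEQ_imp_Cauchy[OF f(2)] unfolding fs by blast
      have "f \<longlonglongrightarrow> snd p" unfolding fs using p(2) by (rule tendsto_snd)
      then have "l = snd p" using f(2) LIMSEQ_unique by blast
      then show "l \<in> snd ` G" using p(1) by blast
    qed
    show "x = 0" if "\<And>y. y \<in> snd ` G \<Longrightarrow> inner x y = 0" for x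
      using that aG by (intro total') force
  qed
  have "\<exists>y. (x, y) \<in> G" for x using fst_UNIV by (metis UNIV_I imageE prod.collapse)
  then obtain W where W: "\<And>x. (x, W x) \<in> G" by metis
  \<comment> \<open>Points of G with equal first coordinates have second coordinates at distance 0,
    so G is a graph.\<close>
  have unique: "y = W x" if "(x, y) \<in> G" for x y
    using isoD[OF that W[of x]] by simp
  have inner: "inner (W x) (W y) = inner x y" for x y using isoG[OF W[of x] W[of y]] by simp
  have "bounded_linear W"
  proof (rule bounded_linear_intro[where K = 1])
    show "W (x + y) = W x + W y" for x y
      using subspace_add[OF subG W[of x] W[of y]] unique by simp
    show "W (r *\<^sub>R x) = r *\<^sub>R W x" for r x
      using unique[of "r *\<^sub>R x" "r *\<^sub>R W x"] subspace_scale[OF subG W[of x], of r] by simp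
    show "norm (W x) \<le> norm x * 1" for x using inner[of x x] by (simp add: norm_eq_sqrt_inner)
  qed
  moreover have "surj W"
    using snd_UNIV unique unfolding surj_def by (metis UNIV_I imageE prod.collapse)
  ultimately show ?thesis using that[OF _ _ inner] unique aG by metis
qed

section \<open>Fock space\<close>

lemma Rep_minus_fock: "Rep_fock (f - g) xs = Rep_fock f xs - Rep_fock g xs"
  by (simp only: minus_fock_def plus_fock.rep_eq uminus_fock.rep_eq) simp

lemma norm_fock_square: "(norm f)\<^sup>2 = (\<Sum>\<^sub>\<infinity>xs. (cmod (Rep_fock f xs))\<^sup>2)"
  by (simp add: power2_norm_eq_inner inner_fock_def fock_inner_self)

lemma cmod_Rep_fock_le: "cmod (Rep_fock f xs) \<le> norm f"
proof -
  have "sum (\<lambda>xs. (cmod (Rep_fock f xs))\<^sup>2) {xs} \<le> (norm f)\<^sup>2"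
    unfolding norm_fock_square by (rule finite_sum_le_infsum) (auto simp: fock_square_summable)
  then show ?thesis by (simp add: power2_le_iff_abs_le)
qed

text \<open>Completeness of square-summable families: coordinates are continuous, so limits exist
  coordinatewise, and the symmetry condition survives such limits.\<close>

instance fock :: (type) complete_space
proof
  fix X :: "nat \<Rightarrow> 'a fock" assume X: "Cauchy X"
  have "Cauchy (\<lambda>n. Rep_fock (X n) xs)" for xs
  proof (rule metric_CauchyI)
    fix e :: real assume "0 < e"
    then obtain M where M: "\<And>m n. m \<ge> M \<Longrightarrow> n \<ge> M \<Longrightarrow> dist (X m) (X n) < e"
      using metric_CauchyD[OF X, of e] by auto
    have "dist (Rep_fock (X m) xs) (Rep_fock (X n) xs) \<le> dist (X m) (X n)" for m n
      using cmod_Rep_fock_le[of "X m - X n" xs] by (simp add: dist_norm Rep_minus_fock)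
    then show "\<exists>M. \<forall>m\<ge>M. \<forall>n\<ge>M. dist (Rep_fock (X m) xs) (Rep_fock (X n) xs) < e"
      using M le_less_trans by blast
  qed
  then have "\<forall>xs. \<exists>l. (\<lambda>n. Rep_fock (X n) xs) \<longlonglongrightarrow> l"
    using Cauchy_convergent convergent_def by blast
  then obtain g where g: "\<And>xs. (\<lambda>n. Rep_fock (X n) xs) \<longlonglongrightarrow> g xs" by metis
  have sym: "g xs = g ys" if "mset xs = mset ys" for xs ys
    using g[of xs] g[of ys] LIMSEQ_unique unfolding fock_symmetric[OF that] by blast
  \<comment> \<open>The limit in m is taken on finite sets F, where it commutes with the sum; the
    bound is uniform in F and so controls the whole norm.\<close>
  have fin: "(\<Sum>xs\<in>F. (cmod (Rep_fock (X n) xs - g xs))\<^sup>2) \<le> e\<^sup>2"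
    if F: "finite F" and e: "\<And>m. m \<ge> n \<Longrightarrow> dist (X n) (X m) \<le> e" for F n e
  proof (rule LIMSEQ_le_const2)
    show "(\<lambda>m. \<Sum>xs\<in>F. (cmod (Rep_fock (X n) xs - Rep_fock (X m) xs))\<^sup>2) \<longlonglongrightarrow>
        (\<Sum>xs\<in>F. (cmod (Rep_fock (X n) xs - g xs))\<^sup>2)"
      by (intro tendsto_intros g)
    have "(\<Sum>xs\<in>F. (cmod (Rep_fock (X n) xs - Rep_fock (X m) xs))\<^sup>2) \<le> e\<^sup>2" if "m \<ge> n" for m
    proof -
      have "(\<Sum>xs\<in>F. (cmod (Rep_fock (X n - X m) xs))\<^sup>2) \<le> (norm (X n - X m))\<^sup>2"
        unfolding norm_fock_square by (rule finite_sum_le_infsum) (auto simp: fock_square_summable F)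
      also have "\<dots> \<le> e\<^sup>2" using e[OF that] by (intro power_mono) (auto simp: dist_norm)
      finally show ?thesis by (simp add: Rep_minus_fock)
    qed
    then show "\<exists>N. \<forall>m\<ge>N. (\<Sum>xs\<in>F. (cmod (Rep_fock (X n) xs - Rep_fock (X m) xs))\<^sup>2) \<le> e\<^sup>2" by blast
  qed
  have summ: "(\<lambda>xs. (cmod (Rep_fock (X n) xs - g xs))\<^sup>2) summable_on UNIV"
    if "\<And>m. m \<ge> n \<Longrightarrow> dist (X n) (X m) \<le> e" for n e
    using fin[OF _ that] by (intro nonneg_bdd_above_summable_on bdd_aboveI2[where M = "e\<^sup>2"]) auto
  obtain N where N: "\<And>m n. m \<ge> N \<Longrightarrow> n \<ge> N \<Longrightarrow> dist (X m) (X n) < 1"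
    using metric_CauchyD[OF X, of 1] by auto
  have "(\<lambda>xs. (cmod (Rep_fock (X N) xs + - 1 * (Rep_fock (X N) xs - g xs)))\<^sup>2) summable_on UNIV"
    using N[of N] by (intro square_summable_add square_summable_mult[where C = 1] fock_square_summable summ[of N 1])
       (auto intro: less_imp_le)
  then have "(\<lambda>xs. (cmod (g xs))\<^sup>2) summable_on UNIV" by simp
  then have Rep: "Rep_fock (Abs_fock g) = g"
    using sym by (intro Abs_fock_inverse) blast
  have "X \<longlonglongrightarrow> Abs_fock g"
  proof (rule metric_LIMSEQ_I)
    fix e :: real assume "0 < e"
    then obtain M where M: "\<And>m n. m \<ge> M \<Longrightarrow> n \<ge> M \<Longrightarrow> dist (X m) (X n) < e / 2"
      using metric_CauchyD[OF X, of "e/2"] by auto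
    have "dist (X n) (Abs_fock g) < e" if "n \<ge> M" for n
    proof -
      have le: "dist (X n) (X m) \<le> e / 2" if "m \<ge> n" for m
        using M[OF \<open>n \<ge> M\<close>, of m] that \<open>n \<ge> M\<close> by simp
      have "(norm (X n - Abs_fock g))\<^sup>2 \<le> (e / 2)\<^sup>2"
        unfolding norm_fock_square Rep_minus_fock Rep
        by (intro infsum_le_finite_sums summ[OF le] fin[OF _ le]) auto
      then have "norm (X n - Abs_fock g) \<le> e / 2"
        using \<open>0 < e\<close> by (auto intro: power2_le_imp_le)
      then show ?thesis using \<open>0 < e\<close> by (simp add: dist_norm)
    qed
    then show "\<exists>no. \<forall>n\<ge>no. dist (X n) (Abs_fock g) < e" by blast
  qed
  then show "convergent X" by (rule convergentI)
qed

lemma fock_inner_add_left: "fock_inner (f + g) h = fock_inner f h + fock_inner g h"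
  using arg_cong[OF fock_inner_add_right[of h f g], of cnj] by (simp add: fock_inner_cnj)

lemma fock_inner_scale_left: "fock_inner (c *\<^sub>C f) g = cnj c * fock_inner f g"
  using arg_cong[OF fock_inner_scale_right[of g c f], of cnj] by (simp add: fock_inner_cnj)

lemma norm_fock_scale: "norm (c *\<^sub>C f) = cmod c * norm f"
proof -
  have "fock_inner (c *\<^sub>C f) (c *\<^sub>C f) = of_real ((cmod c)\<^sup>2) * fock_inner f f"
    unfolding complex_norm_square by (simp add: fock_inner_scale_left fock_inner_scale_right)
  then show ?thesis by (simp add: norm_eq_sqrt_inner inner_fock_def real_sqrt_mult del: of_real_power)
qed

lemma fock_scale_assoc: "a *\<^sub>C (b *\<^sub>C f) = (a * b) *\<^sub>C f"
  by (simp add: Rep_fock_inject[symmetric] fun_eq_iff fock_scale.rep_eq)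

lemma fock_scale_one [simp]: "1 *\<^sub>C f = f"
  by (simp add: Rep_fock_inject[symmetric] fun_eq_iff fock_scale.rep_eq)

lemma bounded_linear_fock_scale: "bounded_linear (\<lambda>f. c *\<^sub>C f)"
  by (rule bounded_linear_intro[where K = "cmod c"])
     (simp_all add: Rep_fock_inject[symmetric] fun_eq_iff fock_scale.rep_eq plus_fock.rep_eq
       scaleR_fock_def norm_fock_scale algebra_simps)

text \<open>Multiplying g by a phase makes the complex inner product real and nonnegative, which
  reduces the claim to the real Cauchy-Schwarz inequality.\<close>

lemma cmod_fock_inner_le: "cmod (fock_inner f g) \<le> norm f * norm g"
proof (cases "fock_inner f g = 0")
  case False
  define c where "c = cnj (fock_inner f g) / of_real (cmod (fock_inner f g))"
  have c: "cmod c = 1" using False by (simp add: c_def norm_divide)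
  have "fock_inner f (c *\<^sub>C g) = of_real (cmod (fock_inner f g))"
    using False unfolding fock_inner_scale_right c_def
    using complex_norm_square[of "fock_inner f g"]
    by (simp add: field_simps power2_eq_square)
  then have "cmod (fock_inner f g) = inner f (c *\<^sub>C g)" by (simp add: inner_fock_def)
  also have "\<dots> \<le> norm f * norm (c *\<^sub>C g)" by (rule norm_cauchy_schwarz)
  finally show ?thesis by (simp add: norm_fock_scale c)
qed simp

lemma bounded_linear_fock_inner_right: "bounded_linear (fock_inner f)"
  by (rule bounded_linear_intro[where K = "norm f"])
     (simp_all add: fock_inner_add_right fock_inner_scale_right scaleR_fock_def scaleR_conv_of_real
       mult.commute[of _ "norm f"] cmod_fock_inner_le)

lemma bounded_linear_fock_inner_left: "bounded_linear (\<lambda>f. fock_inner f g)"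
  by (rule bounded_linear_intro[where K = "norm g"])
     (simp_all add: fock_inner_add_left fock_inner_scale_left scaleR_fock_def scaleR_conv_of_real
       cmod_fock_inner_le)

lemmas fock_inner_zero_right [simp] = linear_0 [OF bounded_linear.linear [OF bounded_linear_fock_inner_right]]
lemmas fock_inner_zero_left [simp] = linear_0 [OF bounded_linear.linear [OF bounded_linear_fock_inner_left]]
lemmas fock_inner_diff_right = linear_diff [OF bounded_linear.linear [OF bounded_linear_fock_inner_right]]
lemmas fock_inner_diff_left = linear_diff [OF bounded_linear.linear [OF bounded_linear_fock_inner_left]]
lemmas fock_inner_sum_right = linear_sum [OF bounded_linear.linear [OF bounded_linear_fock_inner_right]]

text \<open>The multiples by 1 and -i read off the real and the imaginary part of the complex inner
  product from the real one.\<close>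

lemma real_total_of_complex_total:
  assumes "\<And>i c. inner f (c *\<^sub>C a i) = 0" and "(\<And>i. fock_inner (a i) f = 0) \<Longrightarrow> f = 0"
  shows "f = 0"
proof (rule assms(2))
  fix i
  have "Re (fock_inner f (a i)) = 0" using assms(1)[of 1 i] by (simp add: inner_fock_def)
  moreover have "Im (fock_inner f (a i)) = 0"
    using assms(1)[of "- \<i>" i] by (simp add: inner_fock_def fock_inner_scale_right)
  ultimately have "fock_inner f (a i) = 0" by (simp add: complex_eq_iff)
  then show "fock_inner (a i) f = 0" using fock_inner_cnj[of f "a i"] by simp
qed

section \<open>Sums graded by degree and totality of the exponential vectors\<close>

lemma sum_levels:
  fixes h :: "'i \<Rightarrow> nat"
  assumes fin: "\<And>r. finite {x. h x = r}"
  shows "(\<Sum>r<K. \<Sum>x | h x = r. f x) = sum f {x. h x < K}" and "finite {x. h x < K}"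
proof -
  have "{x. h x < K} = (\<Union>r\<in>{..<K}. {x. h x = r})" by auto
  then show "(\<Sum>r<K. \<Sum>x | h x = r. f x) = sum f {x. h x < K}" "finite {x. h x < K}"
    using fin by (simp_all only:) (intro sum.UNION_disjoint[symmetric], auto)
qed

text \<open>The sets of elements of level below K are finite and eventually contain every finite
  set, so the unconditional sum is the limit along them. Used for the length of lists and the size
  of multisets.\<close>

lemma has_sum_levels:
  fixes f :: "'i \<Rightarrow> 'b::{comm_monoid_add,topological_space,real_normed_vector}"
  assumes "(f has_sum s) UNIV" and fin: "\<And>r. finite {x. h x = (r::nat)}"
  shows "(\<lambda>r. \<Sum>x | h x = r. f x) sums s"
proof -
  have "filterlim (\<lambda>K. {x. h x < K}) (finite_subsets_at_top UNIV) sequentially"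
    unfolding filterlim_finite_subsets_at_top
  proof safe
    fix Y :: "'i set" assume Y: "finite Y"
    then obtain K where K: "\<And>x. x \<in> Y \<Longrightarrow> h x < K"
      using finite_nat_set_iff_bounded[THEN iffD1, OF finite_imageI[OF Y, of h]] by blast
    then show "\<forall>\<^sub>F k in sequentially. finite {x. h x < k} \<and> Y \<subseteq> {x. h x < k} \<and> {x. h x < k} \<subseteq> UNIV"
      using K sum_levels(2)[OF fin] by (intro eventually_sequentiallyI[of K]) (auto intro: less_le_trans)
  qed
  then have "(\<lambda>K. sum f {x. h x < K}) \<longlonglongrightarrow> s"
    using assms(1) unfolding has_sum_def by (rule filterlim_compose[rotated])
  then show ?thesis unfolding sums_def sum_levels(1)[OF fin] .
qed

lemma finite_lists_of_length: "finite {xs :: 'a::finite list. length xs = r}"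
  using sum_lists_length_prod_list by blast

text \<open>\<open>sum_lists_length_prod_list\<close> covers real weights only; the inner products
  below need complex ones.\<close>

lemma sum_prod_list_lists_of_length:
  fixes f :: "'a::finite \<Rightarrow> 'b::comm_semiring_1"
  shows "(\<Sum>xs | length xs = r. \<Prod>i\<leftarrow>xs. f i) = (\<Sum>i\<in>UNIV. f i) ^ r"
proof (induction r)
  case (Suc r)
  have inj: "inj_on (\<lambda>(i :: 'a, xs). i # xs) (UNIV \<times> {xs. length xs = r})"
    by (auto simp: inj_on_def)
  show ?case
    using Suc unfolding lists_length_Suc sum.reindex[OF inj]
    by (simp add: case_prod_unfold comp_def sum.cartesian_product' sum_product
        flip: sum_distrib_left sum_distrib_right)
qed simp

text \<open>Expanding the r-th power of the inner product over words of length r identifies the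
  degree r part with the r-th term of the exponential series.\<close>

lemma fock_inner_exp_vec: "fock_inner (exp_vec v) (exp_vec w) = exp (cvec_inner v w)"
proof -
  let ?g = "\<lambda>xs. cnj (Rep_fock (exp_vec v) xs) * Rep_fock (exp_vec w) xs"
  have prod: "cnj (\<Prod>i\<leftarrow>xs. v $ i) * (\<Prod>i\<leftarrow>xs. w $ i) = (\<Prod>i\<leftarrow>xs. cnj (v $ i) * w $ i)" for xs
    by (induction xs) (simp_all add: algebra_simps)
  have g: "?g xs = (\<Prod>i\<leftarrow>xs. cnj (v $ i) * w $ i) / fact (length xs)" for xs
    using prod[of xs] real_sqrt_mult_self[of "fact (length xs)"]
    by (simp add: exp_vec.rep_eq flip: of_real_mult)
  have "(\<lambda>r. \<Sum>xs | length xs = r. ?g xs) sums fock_inner (exp_vec v) (exp_vec w)"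
    unfolding fock_inner_def
    by (intro has_sum_levels has_sum_infsum fock_inner_summable finite_lists_of_length)
  moreover have "(\<Sum>xs | length xs = r. ?g xs) = cvec_inner v w ^ r /\<^sub>R fact r" for r
    unfolding g cvec_inner_def sum_prod_list_lists_of_length[symmetric]
    by (simp add: scaleR_conv_of_real divide_inverse sum_distrib_left mult.commute)
  ultimately show ?thesis using exp_converges[of "cvec_inner v w"] sums_unique2 by auto
qed

text \<open>Convergence at 1 gives a positive radius of convergence, where a power series is
  determined by its values.\<close>

lemma powser_eq_0_imp_coeff_eq_0:
  fixes a :: "nat \<Rightarrow> complex"
  assumes "\<And>z. (\<lambda>n. a n * z ^ n) sums 0"
  shows "a n = 0"
proof -
  have "ereal (norm (1 :: complex)) \<le> conv_radius a"
    by (rule conv_radius_geI[OF sums_summable[OF assms]])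
  then have "fps_conv_radius (Abs_fps a) > 0"
    by (auto simp: fps_conv_radius_def one_ereal_def[symmetric] intro: less_le_trans[of 0 1])
  moreover have "eval_fps (Abs_fps a) z = eval_fps 0 z" for z
    using sums_unique[OF assms[of z]] by (simp add: eval_fps_def)
  ultimately have "Abs_fps a = 0" by (intro eval_fps_eqD) auto
  then show ?thesis by (metis fps_nth_Abs_fps fps_zero_nth)
qed

text \<open>Finitely many distinct nodes are separated by a polynomial.\<close>

lemma power_sums_eq_0:
  fixes m :: "'i \<Rightarrow> complex" and c :: "'i \<Rightarrow> complex"
  assumes fin: "finite X" and sums: "\<And>k. (\<Sum>x\<in>X. m x ^ k * c x) = 0"
  shows "(\<Sum>x | x \<in> X \<and> m x = a. c x) = 0"
proof -
  \<comment> \<open>q vanishes at all values of m on X except a, and not at a; the vanishing power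
    sums then isolate the fibre over a.\<close>
  define q where "q = (\<Prod>b\<in>m ` X - {a}. [:- b, 1:])"
  have "(\<Sum>x\<in>X. poly q (m x) * c x) = (\<Sum>k\<le>degree q. coeff q k * (\<Sum>x\<in>X. m x ^ k * c x))"
    by (simp add: poly_altdef sum_distrib_left sum_distrib_right mult.assoc sum.swap[of _ _ X])
  then have "0 = (\<Sum>x\<in>X. poly q (m x) * c x)" by (simp add: sums)
  also have "\<dots> = (\<Sum>x | x \<in> X \<and> m x = a. poly q (m x) * c x)"
    using fin by (intro sum.mono_neutral_right) (auto simp: q_def poly_prod)
  also have "\<dots> = poly q a * (\<Sum>x | x \<in> X \<and> m x = a. c x)"
    by (simp add: sum_distrib_left)
  finally show ?thesis using fin by (simp add: q_def poly_prod)
qed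

text \<open>Unique factorization: if the letters are distinct primes, the product of a word
  determines how often each letter occurs.\<close>

lemma ex_mset_injective_weight:
  "\<exists>p :: 'a::finite \<Rightarrow> nat. \<forall>xs ys. (\<Prod>i\<leftarrow>xs. p i) = (\<Prod>i\<leftarrow>ys. p i) \<longrightarrow> mset xs = mset ys"
proof -
  define p :: "'a \<Rightarrow> nat" where "p = (\<lambda>i. enumerate {p. prime p} (to_nat i))"
  have prime: "prime (p i)" for i
    using enumerate_in_set[OF primes_infinite, of "to_nat i"] by (simp add: p_def)
  have "inj (enumerate {p :: nat. prime p})"
    using strict_mono_imp_inj_on[OF strict_mono_enumerate[OF primes_infinite]] .
  from inj_compose[OF this inj_to_nat] have inj: "inj p" by (simp add: p_def comp_def)
  have fact: "prime_factorization (\<Prod>i\<leftarrow>xs. p i) = image_mset p (mset xs)" for xs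
    using prime_factorization_prod_mset_primes[of "image_mset p (mset xs)"] prime
    by (auto simp flip: prod_mset_prod_list)
  show ?thesis
  proof (intro exI[of _ p] allI impI)
    fix xs ys assume "(\<Prod>i\<leftarrow>xs. p i) = (\<Prod>i\<leftarrow>ys. p i)"
    then have "image_mset p (mset xs) = image_mset p (mset ys)" by (simp flip: fact)
    then show "mset xs = mset ys" using multiset.inj_map[OF inj] by (simp add: inj_eq)
  qed
qed

text \<open>Rescaling \<open>v\<close> separates the homogeneous components of \<open>\<langle>e(v), f\<rangle>\<close>; within one degree, the
  substitution \<open>v\<^sub>i = p\<^sub>i\<^sup>k\<close> with distinct primes \<open>p\<^sub>i\<close> separates the monomials.\<close>

lemma exp_vec_total:
  fixes f :: "'n::finite fock"
  assumes "\<And>v. fock_inner (exp_vec v) f = 0"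
  shows "f = 0"
proof -
  have homogeneous: "(\<Sum>xs | length xs = r. (\<Prod>i\<leftarrow>xs. u i) * Rep_fock f xs) = 0" for r and u :: "'n \<Rightarrow> complex"
  proof -
    define a where "a r = (\<Sum>xs | length xs = r. (\<Prod>i\<leftarrow>xs. u i) * Rep_fock f xs) / of_real (sqrt (fact r))" for r
    have "(\<lambda>r. a r * z ^ r) sums 0" for z
    proof -
      \<comment> \<open>Conjugated because the inner product is antilinear in its first
        argument.\<close>
      define v where "v = (\<chi> i. cnj (z * u i))"
      have prod: "cnj (\<Prod>i\<leftarrow>xs. v $ i) = z ^ length xs * (\<Prod>i\<leftarrow>xs. u i)" for xs
        by (induction xs) (simp_all add: v_def)
      have "(\<lambda>r. \<Sum>xs | length xs = r. cnj (Rep_fock (exp_vec v) xs) * Rep_fock f xs)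
          sums fock_inner (exp_vec v) f"
        unfolding fock_inner_def
        by (intro has_sum_levels has_sum_infsum fock_inner_summable finite_lists_of_length)
      moreover have "(\<Sum>xs | length xs = r. cnj (Rep_fock (exp_vec v) xs) * Rep_fock f xs) = a r * z ^ r" for r
        by (simp add: a_def exp_vec.rep_eq prod sum_divide_distrib sum_distrib_left mult_ac)
      ultimately show ?thesis using assms by simp
    qed
    then have "a r = 0" by (rule powser_eq_0_imp_coeff_eq_0)
    then show ?thesis by (simp add: a_def)
  qed
  obtain p :: "'n \<Rightarrow> nat" where p: "\<And>xs ys. (\<Prod>i\<leftarrow>xs. p i) = (\<Prod>i\<leftarrow>ys. p i) \<Longrightarrow> mset xs = mset ys"
    using ex_mset_injective_weight by metis
  have "Rep_fock f ys = 0" for ys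
  proof -
    let ?X = "{xs :: 'n list. length xs = length ys}"
    let ?m = "\<lambda>xs. of_nat (\<Prod>i\<leftarrow>xs. p i) :: complex"
    have "(\<Prod>i\<leftarrow>xs. of_nat (p i) ^ k) = ?m xs ^ k" for xs k
      by (induction xs) (simp_all add: power_mult_distrib)
    then have "(\<Sum>xs\<in>?X. ?m xs ^ k * Rep_fock f xs) = 0" for k
      using homogeneous[where r = "length ys" and u = "\<lambda>i. of_nat (p i) ^ k"] by simp
    then have sum0: "(\<Sum>xs | xs \<in> ?X \<and> ?m xs = ?m ys. Rep_fock f xs) = 0"
      by (intro power_sums_eq_0 finite_lists_of_length)
    \<comment> \<open>By the choice of p this is the set of rearrangements of \<open>ys\<close>, on
      which f is constant; the sum is a positive multiple of the single coordinate.\<close>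
    define Y where "Y = {xs. xs \<in> ?X \<and> ?m xs = ?m ys}"
    have "Rep_fock f xs = Rep_fock f ys" if "xs \<in> Y" for xs
      using that unfolding Y_def mem_Collect_eq of_nat_eq_iff by (intro fock_symmetric p) blast
    then have "sum (Rep_fock f) Y = (\<Sum>xs\<in>Y. Rep_fock f ys)" by (rule sum.cong[OF refl])
    then have "of_nat (card Y) * Rep_fock f ys = 0"
      using sum0 unfolding Y_def[symmetric] sum_constant by (rule trans[OF sym])
    moreover have "finite Y" "ys \<in> Y"
      unfolding Y_def using finite_lists_of_length[of "length ys"] by auto
    then have "card Y \<noteq> 0" by auto
    ultimately show ?thesis by simp
  qed
  then show ?thesis by (simp add: Rep_fock_inject[symmetric] fun_eq_iff zero_fock.rep_eq)
qed

section \<open>The occupation number basis\<close>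

lemma finite_lists_of_mset: "finite {xs :: 'n::finite list. mset xs = M}"
  by (rule finite_subset[OF _ finite_lists_of_length[of "size M"]]) auto

lemma card_lists_of_mset_pos: "card {xs :: 'n::finite list. mset xs = M} > 0"
  using finite_lists_of_mset[of M] ex_mset[of M] by (auto simp: card_gt_0_iff)

text \<open>\<open>occ_vec M\<close> is the occupation number state with \<open>count M i\<close> particles in mode \<open>i\<close>.\<close>

lift_definition occ_vec :: "'n multiset \<Rightarrow> 'n::finite fock"
  is "\<lambda>M xs. if mset xs = M then 1 / complex_of_real (sqrt (card {ys. mset ys = M})) else 0"
proof (intro conjI allI impI)
  fix M :: "'n multiset"
  show "(\<lambda>xs. (cmod (if mset xs = M then 1 / complex_of_real (sqrt (card {ys. mset ys = M})) else 0))\<^sup>2) summable_on UNIV"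
    using finite_lists_of_mset[of M]
    by (intro finite_nonzero_values_imp_summable_on finite_subset[OF _ finite_lists_of_mset[of M]]) auto
qed auto

text \<open>All rearrangements contribute the same coordinate, so their number divided by its own
  square root remains as the factor.\<close>

lemma fock_inner_occ_vec:
  assumes "mset xs = M"
  shows "fock_inner (occ_vec M) f = of_real (sqrt (card {ys. mset ys = M})) * Rep_fock f xs"
proof -
  have "fock_inner (occ_vec M) f = (\<Sum>\<^sub>\<infinity>ys\<in>{ys. mset ys = M}. Rep_fock f ys / of_real (sqrt (card {ys. mset ys = M})))"
    unfolding fock_inner_def by (rule infsum_cong_neutral) (auto simp: occ_vec.rep_eq)
  also have "\<dots> = (\<Sum>ys | mset ys = M. Rep_fock f xs / of_real (sqrt (card {ys. mset ys = M})))"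
    unfolding infsum_finite[OF finite_lists_of_mset]
    using assms by (intro sum.cong refl arg_cong2[where f = "(/)"] fock_symmetric) auto
  also have "\<dots> = of_real (card {ys. mset ys = M} / sqrt (card {ys. mset ys = M})) * Rep_fock f xs"
    by simp
  finally show ?thesis by (simp add: real_div_sqrt)
qed

lemma fock_inner_occ_occ: "fock_inner (occ_vec M) (occ_vec M') = (if M = M' then 1 else 0)"
proof -
  obtain xs where "mset xs = M" using ex_mset by blast
  then show ?thesis
    using card_lists_of_mset_pos[of M] by (auto simp: fock_inner_occ_vec occ_vec.rep_eq)
qed

lemma norm_occ_vec [simp]: "norm (occ_vec M) = 1"
  by (simp add: norm_eq_sqrt_inner inner_fock_def fock_inner_occ_occ)

lemma inj_occ_vec: "inj occ_vec"
  by (rule injI) (metis fock_inner_occ_occ zero_neq_one)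

lemma occ_vec_eq_iff [simp]: "occ_vec M = occ_vec M' \<longleftrightarrow> M = M'"
  by (rule inj_eq[OF inj_occ_vec])

lemma fock_eqI_occ:
  assumes "\<And>M. fock_inner (occ_vec M) f = fock_inner (occ_vec M) g"
  shows "f = g"
proof -
  have "Rep_fock f xs = Rep_fock g xs" for xs
    using assms[of "mset xs"] card_lists_of_mset_pos[of "mset xs"] by (simp add: fock_inner_occ_vec)
  then show ?thesis by (simp add: Rep_fock_inject[symmetric] fun_eq_iff)
qed

lemma orthonormal_basis_occ_vec: "orthonormal_basis (range (occ_vec :: 'n::finite multiset \<Rightarrow> _))"
proof -
  have "f = 0" if "\<And>M. fock_inner (occ_vec M) f = 0" for f :: "'n::finite fock"
    using that by (intro fock_eqI_occ) simp
  then show ?thesis unfolding orthonormal_basis_def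
    by (intro conjI ballI allI impI) (auto simp only: fock_inner_occ_occ occ_vec_eq_iff)
qed

section \<open>Bessel and Parseval for arbitrary orthonormal bases\<close>

lemma orthonormal_basisD:
  assumes "orthonormal_basis B"
  shows "e \<in> B \<Longrightarrow> e' \<in> B \<Longrightarrow> fock_inner e e' = (if e = e' then 1 else 0)"
    and "(\<And>e. e \<in> B \<Longrightarrow> fock_inner e f = 0) \<Longrightarrow> f = 0"
  by (use assms in \<open>simp only: orthonormal_basis_def\<close>)
     (use assms in \<open>unfold orthonormal_basis_def, meson\<close>)

text \<open>The norm of f - g is nonnegative, where g is the orthogonal projection of f onto the
  span of F.\<close>

lemma Bessel_inequality:
  assumes "orthonormal_basis B" "finite F" "F \<subseteq> B"
  shows "(\<Sum>e\<in>F. (cmod (fock_inner e f))\<^sup>2) \<le> (norm f)\<^sup>2"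
proof -
  have ortho: "fock_inner e e' = (if e = e' then 1 else 0)" if "e \<in> F" "e' \<in> F" for e e'
    using assms(3) that by (intro orthonormal_basisD(1)[OF assms(1)]) auto
  define g where "g = (\<Sum>e\<in>F. fock_inner e f *\<^sub>C e)"
  have eg: "fock_inner e g = fock_inner e f" if "e \<in> F" for e
  proof -
    have "fock_inner e g = (\<Sum>e'\<in>F. if e = e' then fock_inner e' f else 0)"
      unfolding g_def fock_inner_sum_right fock_inner_scale_right
      using that by (intro sum.cong refl) (simp add: ortho)
    then show ?thesis using assms(2) that by simp
  qed
  have hg: "fock_inner h g = (\<Sum>e\<in>F. fock_inner e f * cnj (fock_inner e h))" for h
    by (simp add: g_def fock_inner_sum_right fock_inner_scale_right fock_inner_cnj)
  have gg: "fock_inner g g = of_real (\<Sum>e\<in>F. (cmod (fock_inner e f))\<^sup>2)"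
    unfolding hg[of g] by (simp add: eg complex_norm_square del: of_real_power)
  have fg: "fock_inner f g = of_real (\<Sum>e\<in>F. (cmod (fock_inner e f))\<^sup>2)"
    unfolding hg by (simp add: complex_norm_square del: of_real_power)
  have gf: "fock_inner g f = of_real (\<Sum>e\<in>F. (cmod (fock_inner e f))\<^sup>2)"
    using arg_cong[OF fg, of cnj] by (simp add: fock_inner_cnj)
  have "0 \<le> inner (f - g) (f - g)" by simp
  also have "\<dots> = (norm f)\<^sup>2 - (\<Sum>e\<in>F. (cmod (fock_inner e f))\<^sup>2)"
    by (simp add: power2_norm_eq_inner inner_fock_def fock_inner_diff_left fock_inner_diff_right gg fg gf
        del: of_real_power of_real_sum)
  finally show ?thesis by simp
qed

lemma abs_sum_fock_inner_le:
  assumes "orthonormal_basis B" "finite F" "F \<subseteq> B"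
  shows "(\<Sum>e\<in>F. cmod (fock_inner f e * fock_inner e g)) \<le> norm f * norm g"
proof -
  have cnj: "cmod (fock_inner f e) = cmod (fock_inner e f)" for e
    using arg_cong[OF fock_inner_cnj[of e f], of cmod] by simp
  have "(\<Sum>e\<in>F. cmod (fock_inner f e * fock_inner e g)) =
      (\<Sum>e\<in>F. \<bar>cmod (fock_inner e f)\<bar> * \<bar>cmod (fock_inner e g)\<bar>)"
    by (simp add: norm_mult cnj)
  also have "\<dots> \<le> L2_set (\<lambda>e. cmod (fock_inner e f)) F * L2_set (\<lambda>e. cmod (fock_inner e g)) F"
    by (rule L2_set_mult_ineq)
  also have "\<dots> \<le> norm f * norm g"
    using Bessel_inequality[OF assms] by (intro mult_mono) (auto simp: L2_set_def real_le_lsqrt sum_nonneg)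
  finally show ?thesis .
qed

lemma abs_summable_fock_inner:
  assumes "orthonormal_basis B"
  shows "(\<lambda>e. cmod (fock_inner f e * fock_inner e g)) summable_on B"
    and "(\<Sum>\<^sub>\<infinity>e\<in>B. cmod (fock_inner f e * fock_inner e g)) \<le> norm f * norm g"
proof -
  show *: "(\<lambda>e. cmod (fock_inner f e * fock_inner e g)) summable_on B"
    using abs_sum_fock_inner_le[OF assms]
    by (intro nonneg_bdd_above_summable_on bdd_aboveI2[where M = "norm f * norm g"]) auto
  show "(\<Sum>\<^sub>\<infinity>e\<in>B. cmod (fock_inner f e * fock_inner e g)) \<le> norm f * norm g"
    using abs_sum_fock_inner_le[OF assms] by (intro infsum_le_finite_sums *)
qed

text \<open>Both sides are bounded and linear in g and agree on multiples of basis vectors, which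
  are total.\<close>

lemma Parseval:
  assumes B: "orthonormal_basis B"
  shows "((\<lambda>e. fock_inner f e * fock_inner e g) has_sum fock_inner f g) B"
proof -
  \<comment> \<open>The density lemma wants a family indexed by a type, so vectors outside B are
    replaced by 0.\<close>
  define a where "a i = (if snd i \<in> B then fst i *\<^sub>C snd i else 0)" for i :: "complex \<times> 'a fock"
  define L where "L g = (\<Sum>\<^sub>\<infinity>e\<in>B. fock_inner f e * fock_inner e g)" for g
  note abs = abs_summable_fock_inner[OF B]
  note summ = abs_summable_summable[OF abs(1)]
  have "bounded_linear L"
  proof (rule bounded_linear_intro[where K = "norm f"])
    show "L (g + h) = L g + L h" for g h
      unfolding L_def by (simp add: fock_inner_add_right distrib_left infsum_add summ)
    show "L (r *\<^sub>R g) = r *\<^sub>R L g" for r g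
      unfolding L_def scaleR_fock_def fock_inner_scale_right scaleR_conv_of_real
      by (simp add: mult.left_commute infsum_cmult_right')
    show "norm (L g) \<le> norm g * norm f" for g
      unfolding L_def using norm_infsum_bound[OF abs(1)[of f g]] abs(2)[of f g] by (simp add: mult.commute)
  qed
  moreover have "L (a i) = fock_inner f (a i)" for i
  proof (cases "snd i \<in> B")
    case True
    have "L (a i) = (\<Sum>\<^sub>\<infinity>e\<in>{snd i}. fock_inner f e * fst i)"
      unfolding L_def a_def using True B
      by (intro infsum_cong_neutral) (auto simp: orthonormal_basisD(1)[OF B] fock_inner_scale_right)
    then show ?thesis using True by (simp add: a_def fock_inner_scale_right)
  qed (simp add: L_def a_def)
  moreover have "h = 0" if h: "\<And>i. inner h (a i) = 0" for h
  proof (rule real_total_of_complex_total[where a = "\<lambda>e. if e \<in> B then e else 0"])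
    show "inner h (c *\<^sub>C (if e \<in> B then e else 0)) = 0" for e c
      using h[of "(c, e)"] by (auto simp: a_def inner_fock_def fock_inner_scale_right)
    show "h = 0" if "\<And>e. fock_inner (if e \<in> B then e else 0) h = 0"
    proof -
      have "fock_inner e h = 0" if "e \<in> B" for e
        using \<open>fock_inner (if e \<in> B then e else 0) h = 0\<close> that by simp
      then show ?thesis by (rule orthonormal_basisD(2)[OF B])
    qed
  qed
  ultimately have "L = fock_inner f"
    by (rule bounded_linear_eq_on_total[of L "fock_inner f" a, OF _ bounded_linear_fock_inner_right])
  then show ?thesis unfolding has_sum_iff using summ by (auto simp: L_def fun_eq_iff)
qed

section \<open>Traces and positive operators\<close>

lemma has_traceD:
  "has_trace A t \<Longrightarrow> orthonormal_basis B \<Longrightarrow> ((\<lambda>e. fock_inner e (A e)) has_sum t) B"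
  by (simp add: has_trace_def)

lemma has_trace_unique:
  fixes A :: "'n::finite fock \<Rightarrow> 'n fock"
  shows "has_trace A s \<Longrightarrow> has_trace A t \<Longrightarrow> s = t"
  by (rule has_sum_unique[OF has_traceD has_traceD]) (rule orthonormal_basis_occ_vec | assumption)+

lemma fock_trace_eqI:
  fixes A :: "'n::finite fock \<Rightarrow> 'n fock"
  shows "has_trace A t \<Longrightarrow> fock_trace A = t"
  unfolding fock_trace_def by (rule the_equality) (auto intro: has_trace_unique)

lemma has_trace_occ_vec:
  assumes "has_trace A t"
  shows "((\<lambda>M. fock_inner (occ_vec M) (A (occ_vec M))) has_sum t) UNIV"
  using has_traceD[OF assms orthonormal_basis_occ_vec]
  by (simp add: has_sum_reindex[OF inj_occ_vec] comp_def)

lemma bounded_op_compose: "bounded_op A \<Longrightarrow> bounded_op B \<Longrightarrow> bounded_op (A \<circ> B)"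
  unfolding bounded_op_def by (auto simp: comp_def intro: bounded_linear_compose)

lemma bounded_op_add: "bounded_op A \<Longrightarrow> A (f + g) = A f + A g"
  unfolding bounded_op_def by (metis linear_add bounded_linear.linear)

lemma bounded_op_scale: "bounded_op A \<Longrightarrow> A (c *\<^sub>C f) = c *\<^sub>C A f"
  unfolding bounded_op_def by blast

text \<open>Polarization: the quadratic form is real at f + g and at f + i g, which fixes the
  imaginary and the real part of the difference of the cross terms.\<close>

lemma positive_op_symmetric:
  assumes "positive_op A"
  shows "fock_inner f (A g) = fock_inner (A f) g"
proof -
  have b: "bounded_op A" and re: "\<And>f. Im (fock_inner f (A f)) = 0"
    using assms unfolding positive_op_def by (auto simp: complex_is_Real_iff)
  have "Im (fock_inner f (A g) + fock_inner g (A f)) = 0"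
    using re[of "f + g"] re[of f] re[of g]
    by (simp add: bounded_op_add[OF b] fock_inner_add_left fock_inner_add_right)
  moreover have "Im (\<i> * fock_inner f (A g) - \<i> * fock_inner g (A f)) = 0"
    using re[of "f + \<i> *\<^sub>C g"] re[of f] re[of g]
    by (simp add: bounded_op_add[OF b] bounded_op_scale[OF b] fock_inner_add_left fock_inner_add_right
        fock_inner_scale_left fock_inner_scale_right)
  ultimately have "fock_inner f (A g) = cnj (fock_inner g (A f))" by (simp add: complex_eq_iff)
  then show ?thesis by (simp add: fock_inner_cnj)
qed

text \<open>Positivity at f + c g, where the unimodular c turns both cross terms into minus the
  modulus. The additive form can be summed directly over a basis.\<close>

lemma positive_op_Cauchy_Schwarz:
  assumes "positive_op A"
  shows "2 * cmod (fock_inner f (A g)) \<le> Re (fock_inner f (A f)) + Re (fock_inner g (A g))"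
proof -
  have b: "bounded_op A" and pos: "\<And>f. 0 \<le> Re (fock_inner f (A f))"
    using assms unfolding positive_op_def by auto
  define z where "z = fock_inner f (A g)"
  define c where "c = (if z = 0 then 1 else - cnj z / of_real (cmod z))"
  have c: "cmod c = 1" by (simp add: c_def norm_divide)
  have cz: "c * z = - of_real (cmod z)"
    using complex_norm_square[of z] by (simp add: c_def field_simps power2_eq_square)
  have zc: "fock_inner g (A f) = cnj z"
    unfolding z_def fock_inner_cnj positive_op_symmetric[OF assms] by simp
  have cc: "cnj c * c = 1"
    using complex_norm_square[of c] c by (simp add: mult.commute)
  have "fock_inner (f + c *\<^sub>C g) (A (f + c *\<^sub>C g)) =
      fock_inner f (A f) + c * z + cnj (c * z) + cnj c * c * fock_inner g (A g)"
    by (simp add: bounded_op_add[OF b] bounded_op_scale[OF b] fock_inner_add_left fock_inner_add_right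
        fock_inner_scale_left fock_inner_scale_right zc z_def[symmetric] algebra_simps)
  also have "\<dots> = fock_inner f (A f) + fock_inner g (A g) - of_real (2 * cmod z)"
    unfolding cz cc by simp
  finally show ?thesis using pos[of "f + c *\<^sub>C g"] by (simp add: z_def)
qed

text \<open>Basis independence holds because the double series over \<open>B\<close> and the occupation number basis
  converges absolutely.\<close>

lemma has_trace_compose_diagonal:
  fixes \<rho> A :: "'n::finite fock \<Rightarrow> 'n fock" and a :: "'n multiset \<Rightarrow> complex"
  assumes \<rho>: "positive_op \<rho>" and A: "bounded_op A"
    and diag: "\<And>M f. fock_inner (occ_vec M) (A f) = a M * fock_inner (occ_vec M) f"
    and a: "(\<lambda>M. cmod (a M)) summable_on UNIV"
  shows "has_trace (\<rho> \<circ> A) (\<Sum>\<^sub>\<infinity>M. a M * fock_inner (occ_vec M) (\<rho> (occ_vec M)))"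
  unfolding has_trace_def
proof (intro conjI allI impI)
  have b: "bounded_op \<rho>" using \<rho> by (simp add: positive_op_def)
  show "bounded_op (\<rho> \<circ> A)" using b A by (rule bounded_op_compose)
  obtain K where K: "\<And>f. norm (\<rho> f) \<le> norm f * K"
    using b unfolding bounded_op_def using bounded_linear.bounded by metis
  fix B :: "'n fock set" assume B: "orthonormal_basis B"
  let ?t = "\<lambda>(M, e). a M * (fock_inner (occ_vec M) e * fock_inner e (\<rho> (occ_vec M)))"
  have abs: "(\<lambda>p. norm (?t p)) summable_on UNIV \<times> B"
    unfolding Infinite_Sum.abs_summable_on_Sigma_iff
  proof (intro conjI ballI)
    show "(\<lambda>e. norm (?t (M, e))) summable_on B" for M
      using abs_summable_fock_inner(1)[OF B, of "occ_vec M" "\<rho> (occ_vec M)"]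
      by (simp add: norm_mult summable_on_cmult_right)
    \<comment> \<open>The occupation vectors have norm 1, so Cauchy-Schwarz bounds row M by the
      operator bound K times the modulus of \<open>a M\<close>.\<close>
    have bound: "(\<Sum>\<^sub>\<infinity>e\<in>B. norm (?t (M, e))) \<le> K * norm (a M)" for M
    proof -
      have "(\<Sum>\<^sub>\<infinity>e\<in>B. norm (?t (M, e))) =
          norm (a M) * (\<Sum>\<^sub>\<infinity>e\<in>B. cmod (fock_inner (occ_vec M) e * fock_inner e (\<rho> (occ_vec M))))"
        by (simp add: norm_mult infsum_cmult_right')
      also have "\<dots> \<le> norm (a M) * (norm (occ_vec M) * norm (\<rho> (occ_vec M)))"
        by (intro mult_left_mono abs_summable_fock_inner(2)[OF B]) simp
      also have "\<dots> \<le> norm (a M) * K"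
        using K[of "occ_vec M"] by (intro mult_left_mono) auto
      finally show ?thesis by (simp add: mult.commute)
    qed
    show "(\<lambda>M. norm (\<Sum>\<^sub>\<infinity>e\<in>B. norm (?t (M, e)))) summable_on UNIV"
    proof (rule Infinite_Sum.abs_summable_on_comparison_test)
      show "(\<lambda>M. norm (of_real K * a M)) summable_on UNIV"
        using a by (simp add: norm_mult summable_on_cmult_right)
      show "norm (\<Sum>\<^sub>\<infinity>e\<in>B. norm (?t (M, e))) \<le> norm (of_real K * a M)" for M
      proof -
        have "0 \<le> (\<Sum>\<^sub>\<infinity>e\<in>B. norm (?t (M, e)))" by (intro infsum_nonneg) simp
        moreover have "K * norm (a M) \<le> norm (of_real K * a M)"
          by (simp add: norm_mult mult_right_mono)
        ultimately show ?thesis using bound[of M] by simp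
      qed
    qed
  qed
  have rows: "((\<lambda>e. ?t (M, e)) has_sum a M * fock_inner (occ_vec M) (\<rho> (occ_vec M))) B" for M
    using has_sum_cmult_right[OF Parseval[OF B]] by simp
  \<comment> \<open>Rows are summed by Parseval in B, columns by Parseval in the occupation number
    basis, after moving \<open>\<rho>\<close> to the left vector and using that A is
    diagonal.\<close>
  have columns: "((\<lambda>M. ?t (M, e)) has_sum fock_inner e (\<rho> (A e))) UNIV" for e
  proof -
    have "((\<lambda>g. fock_inner (\<rho> e) g * fock_inner g (A e)) has_sum fock_inner (\<rho> e) (A e)) (range occ_vec)"
      by (rule Parseval[OF orthonormal_basis_occ_vec])
    then have "((\<lambda>M. fock_inner (\<rho> e) (occ_vec M) * fock_inner (occ_vec M) (A e)) has_sum fock_inner (\<rho> e) (A e)) UNIV"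
      by (simp add: has_sum_reindex[OF inj_occ_vec] comp_def)
    then show ?thesis by (simp add: diag positive_op_symmetric[OF \<rho>] mult_ac)
  qed
  have "(?t has_sum (\<Sum>\<^sub>\<infinity>p\<in>UNIV \<times> B. ?t p)) (UNIV \<times> B)"
    using abs_summable_summable[OF abs] by (rule has_sum_infsum)
  moreover from this have "((\<lambda>M. a M * fock_inner (occ_vec M) (\<rho> (occ_vec M))) has_sum (\<Sum>\<^sub>\<infinity>p\<in>UNIV \<times> B. ?t p)) UNIV"
    using rows by (rule has_sum_SigmaD)
  ultimately have "(?t has_sum (\<Sum>\<^sub>\<infinity>M. a M * fock_inner (occ_vec M) (\<rho> (occ_vec M)))) (UNIV \<times> B)"
    using infsumI by fastforce
  then have "((\<lambda>(e, M). ?t (M, e)) has_sum (\<Sum>\<^sub>\<infinity>M. a M * fock_inner (occ_vec M) (\<rho> (occ_vec M)))) (B \<times> UNIV)"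
    by (subst (asm) has_sum_swap) (simp add: case_prod_unfold)
  then have "((\<lambda>e. fock_inner e (\<rho> (A e))) has_sum (\<Sum>\<^sub>\<infinity>M. a M * fock_inner (occ_vec M) (\<rho> (occ_vec M)))) B"
    by (rule has_sum_SigmaD) (use columns in simp)
  then show "((\<lambda>e. fock_inner e ((\<rho> \<circ> A) e)) has_sum (\<Sum>\<^sub>\<infinity>M. a M * fock_inner (occ_vec M) (\<rho> (occ_vec M)))) B"
    by simp
qed

section \<open>The number operator and its generating function\<close>

lemma finite_multisets_of_size: "finite {M :: 'n::finite multiset. size M = r}"
proof -
  have "{M :: 'n multiset. size M = r} \<subseteq> mset ` {xs. length xs = r}"
  proof
    fix M :: "'n multiset" assume "M \<in> {M. size M = r}"
    moreover obtain xs where "mset xs = M" using ex_mset by blast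
    ultimately show "M \<in> mset ` {xs. length xs = r}" by (auto simp flip: size_mset)
  qed
  then show ?thesis using finite_lists_of_length by (rule finite_surj[rotated])
qed

text \<open>The weight factors over the modes. A finite set of multisets lies in a box of occupation
  numbers, and the sum over the box is a product of partial geometric series. This is why x^N is
  trace class for x < 1.\<close>

lemma summable_power_size:
  fixes x :: real
  assumes "0 \<le> x" "x < 1"
  shows "(\<lambda>M :: 'n::finite multiset. x ^ size M) summable_on UNIV"
proof (rule nonneg_bdd_above_summable_on)
  have size: "size M = (\<Sum>i\<in>UNIV. count M i)" for M :: "'n multiset"
    unfolding size_multiset_overloaded_eq by (intro sum.mono_neutral_left) (auto simp: count_eq_zero_iff)
  have "(\<Sum>M\<in>F. x ^ size M) \<le> (1 / (1 - x)) ^ CARD('n)" if F: "finite F" for F :: "'n multiset set"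
  proof -
    obtain R where R: "\<And>M. M \<in> F \<Longrightarrow> size M \<le> R"
      using finite_nat_set_iff_bounded_le[THEN iffD1, OF finite_imageI[OF F, of size]] by blast
    have "(\<Sum>M\<in>F. x ^ size M) = (\<Sum>M\<in>F. \<Prod>i\<in>UNIV. x ^ count M i)"
      by (simp add: size power_sum)
    also have "\<dots> = (\<Sum>g\<in>count ` F. \<Prod>i\<in>UNIV. x ^ g i)"
      by (subst sum.reindex) (auto simp: inj_on_def multiset_eq_iff)
    also have "\<dots> \<le> (\<Sum>g\<in>PiE (UNIV :: 'n set) (\<lambda>_. {..R}). \<Prod>i\<in>UNIV. x ^ g i)"
    proof (rule sum_mono2)
      show "count ` F \<subseteq> PiE (UNIV :: 'n set) (\<lambda>_. {..R})"
        using R count_le_size order.trans by (fastforce simp: PiE_iff)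
    qed (use assms in \<open>auto intro!: finite_PiE prod_nonneg\<close>)
    also have "\<dots> = (\<Prod>i\<in>(UNIV :: 'n set). \<Sum>k\<le>R. x ^ k)"
      by (rule prod_sum_PiE[symmetric]) auto
    also have "\<dots> \<le> (\<Prod>i\<in>(UNIV :: 'n set). 1 / (1 - x))"
    proof (intro prod_mono conjI)
      show "(\<Sum>k\<le>R. x ^ k) \<le> 1 / (1 - x)"
        using assms sum_le_suminf[of "\<lambda>k. x ^ k" "{..R}"] by (simp add: suminf_geometric summable_geometric)
    qed (use assms in \<open>auto intro: sum_nonneg\<close>)
    finally show ?thesis by simp
  qed
  then show "bdd_above (sum (\<lambda>M :: 'n multiset. x ^ size M) ` {F. F \<subseteq> UNIV \<and> finite F})"
    by (intro bdd_aboveI2[where M = "(1 / (1 - x)) ^ CARD('n)"]) auto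
qed (use assms in auto)

lemma bounded_op_number_power:
  assumes "\<bar>x\<bar> \<le> 1"
  shows "bounded_op (number_power x)"
  unfolding bounded_op_def
proof (intro conjI allI)
  note Rep = Rep_number_power[OF assms]
  show "number_power x (c *\<^sub>C f) = c *\<^sub>C number_power x f" for c f
    by (simp add: Rep_fock_inject[symmetric] fun_eq_iff fock_scale.rep_eq Rep)
  show "bounded_linear (number_power x)"
  proof (rule bounded_linear_intro[where K = 1])
    show "number_power x (f + g) = number_power x f + number_power x g" for f g
      by (simp add: Rep_fock_inject[symmetric] fun_eq_iff plus_fock.rep_eq Rep algebra_simps)
    show "number_power x (r *\<^sub>R f) = r *\<^sub>R number_power x f" for r f
      by (simp add: Rep_fock_inject[symmetric] fun_eq_iff scaleR_fock_def fock_scale.rep_eq Rep)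
    show "norm (number_power x f) \<le> norm f * 1" for f
    proof -
      have "(norm (number_power x f))\<^sup>2 \<le> (norm f)\<^sup>2"
        unfolding norm_fock_square
      proof (rule infsum_mono)
        show "(cmod (Rep_fock (number_power x f) xs))\<^sup>2 \<le> (cmod (Rep_fock f xs))\<^sup>2" for xs
          using assms unfolding Rep
          by (intro power_mono) (auto simp: norm_mult norm_power intro!: mult_left_le_one_le power_le_one)
      qed (auto simp: fock_square_summable)
      then have "norm (number_power x f) \<le> norm f" by (rule power2_le_imp_le) simp
      then show ?thesis by simp
    qed
  qed
qed

lemma bounded_op_particle_proj: "bounded_op (particle_proj k)"
  unfolding bounded_op_def
proof (intro conjI allI)
  show "particle_proj k (c *\<^sub>C f) = c *\<^sub>C particle_proj k f" for c f
    by (simp add: Rep_fock_inject[symmetric] fun_eq_iff fock_scale.rep_eq particle_proj.rep_eq)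
  show "bounded_linear (particle_proj k)"
  proof (rule bounded_linear_intro[where K = 1])
    show "particle_proj k (f + g) = particle_proj k f + particle_proj k g" for f g
      by (simp add: Rep_fock_inject[symmetric] fun_eq_iff plus_fock.rep_eq particle_proj.rep_eq)
    show "particle_proj k (r *\<^sub>R f) = r *\<^sub>R particle_proj k f" for r f
      by (simp add: Rep_fock_inject[symmetric] fun_eq_iff scaleR_fock_def fock_scale.rep_eq particle_proj.rep_eq)
    show "norm (particle_proj k f) \<le> norm f * 1" for f
    proof -
      have "(norm (particle_proj k f))\<^sup>2 \<le> (norm f)\<^sup>2"
        unfolding norm_fock_square
        by (rule infsum_mono) (auto simp: particle_proj.rep_eq fock_square_summable
            intro: fock_square_summable[of "particle_proj k f", unfolded particle_proj.rep_eq])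
      then have "norm (particle_proj k f) \<le> norm f" by (rule power2_le_imp_le) simp
      then show ?thesis by simp
    qed
  qed
qed

lemma fock_inner_occ_number_power:
  fixes f :: "'n::finite fock"
  assumes "\<bar>x\<bar> \<le> 1"
  shows "fock_inner (occ_vec M) (number_power x f) = of_real x ^ size M * fock_inner (occ_vec M) f"
proof -
  obtain xs where "mset xs = M" using ex_mset by blast
  then show ?thesis by (auto simp: fock_inner_occ_vec Rep_number_power[OF assms])
qed

lemma fock_inner_occ_particle_proj:
  fixes f :: "'n::finite fock"
  shows "fock_inner (occ_vec M) (particle_proj k f) = (if size M = k then 1 else 0) * fock_inner (occ_vec M) f"
proof -
  obtain xs where "mset xs = M" using ex_mset by blast
  then show ?thesis by (auto simp: fock_inner_occ_vec particle_proj.rep_eq)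
qed

lemma number_power_occ_vec:
  assumes "\<bar>x\<bar> \<le> 1"
  shows "number_power x (occ_vec M) = of_real x ^ size M *\<^sub>C occ_vec M"
  by (rule fock_eqI_occ)
     (simp add: fock_inner_occ_number_power[OF assms] fock_inner_scale_right fock_inner_occ_occ)

text \<open>x^N is the second quantization of the scalar x; its matrix elements between exponential
  vectors are therefore again exponentials.\<close>

lemma number_power_exp_vec:
  assumes "\<bar>x\<bar> \<le> 1"
  shows "number_power x (exp_vec v) = exp_vec (\<chi> i. of_real x * v $ i)"
proof -
  have "(\<Prod>i\<leftarrow>xs. of_real x * v $ i) = of_real x ^ length xs * (\<Prod>i\<leftarrow>xs. v $ i)" for xs
    by (induction xs) simp_all
  then show ?thesis
    by (simp add: Rep_fock_inject[symmetric] fun_eq_iff Rep_number_power[OF assms] exp_vec.rep_eq)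
qed

text \<open>The projection is diagonal in the occupation number basis with finitely many nonzero
  entries. Positivity makes the diagonal of \<open>\<rho>\<close> real, so the real part taken in
  \<open>number_prob\<close> loses nothing.\<close>

lemma number_prob_eq:
  fixes \<rho> :: "'n::finite fock \<Rightarrow> 'n fock"
  assumes "positive_op \<rho>"
  shows "complex_of_real (number_prob \<rho> k) = (\<Sum>M | size M = k. fock_inner (occ_vec M) (\<rho> (occ_vec M)))"
proof -
  let ?s = "\<Sum>M | size M = k. fock_inner (occ_vec M) (\<rho> (occ_vec M))"
  have "has_trace (\<rho> \<circ> particle_proj k)
     (\<Sum>\<^sub>\<infinity>M. (if size M = k then 1 else 0) * fock_inner (occ_vec M) (\<rho> (occ_vec M)))"
  proof (rule has_trace_compose_diagonal[OF assms bounded_op_particle_proj fock_inner_occ_particle_proj])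
    show "(\<lambda>M :: 'n multiset. cmod (if size M = k then 1 else 0)) summable_on UNIV"
      by (intro finite_nonzero_values_imp_summable_on finite_subset[OF _ finite_multisets_of_size[of k]]) auto
  qed
  also have "(\<Sum>\<^sub>\<infinity>M. (if size M = k then 1 else 0) * fock_inner (occ_vec M) (\<rho> (occ_vec M))) =
      (\<Sum>\<^sub>\<infinity>M\<in>{M. size M = k}. fock_inner (occ_vec M) (\<rho> (occ_vec M)))"
    by (rule infsum_cong_neutral) auto
  also have "\<dots> = ?s" using finite_multisets_of_size by (rule infsum_finite)
  finally have "fock_trace (\<rho> \<circ> particle_proj k) = ?s" by (rule fock_trace_eqI)
  moreover have "?s \<in> \<real>" using assms unfolding positive_op_def by (intro sum_in_Reals) blast
  ultimately show ?thesis unfolding number_prob_def by (simp only: of_real_Re)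
qed

text \<open>Grouping the diagonal sum by particle number turns the trace into the generating series.
  The value t is left open; the Weyl integral computes it.\<close>

lemma has_trace_number_power:
  fixes \<rho> :: "'n::finite fock \<Rightarrow> 'n fock"
  assumes "positive_op \<rho>" and x: "0 \<le> x" "x < 1"
  obtains t where "has_trace (\<rho> \<circ> number_power x) t"
    and "(\<lambda>k. complex_of_real (number_prob \<rho> k * x ^ k)) sums t"
proof -
  let ?t = "\<Sum>\<^sub>\<infinity>M. of_real x ^ size M * fock_inner (occ_vec M) (\<rho> (occ_vec M))"
  have x1: "\<bar>x\<bar> \<le> 1" using x by simp
  have "has_trace (\<rho> \<circ> number_power x) ?t"
  proof (rule has_trace_compose_diagonal[OF assms(1) bounded_op_number_power[OF x1] fock_inner_occ_number_power[OF x1]])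
    show "(\<lambda>M :: 'n multiset. cmod (of_real x ^ size M)) summable_on UNIV"
      using summable_power_size[OF x] x by (simp add: norm_power)
  qed
  moreover from has_trace_occ_vec[OF this]
  have "((\<lambda>M. of_real x ^ size M * fock_inner (occ_vec M) (\<rho> (occ_vec M))) has_sum ?t) UNIV"
    using assms(1) by (simp add: number_power_occ_vec[OF x1] positive_op_def bounded_op_scale fock_inner_scale_right)
  from has_sum_levels[OF this finite_multisets_of_size]
  have "(\<lambda>k. \<Sum>M | size M = k. of_real x ^ size M * fock_inner (occ_vec M) (\<rho> (occ_vec M))) sums ?t" .
  moreover have "(\<Sum>M | size M = k. of_real x ^ size M * fock_inner (occ_vec M) (\<rho> (occ_vec M))) =
      complex_of_real (number_prob \<rho> k * x ^ k)" for k
    unfolding of_real_mult number_prob_eq[OF assms(1)] sum_distrib_right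
    by (intro sum.cong refl) auto
  ultimately show ?thesis using that by simp
qed

section \<open>Weyl operators\<close>

lemma cvec_inner_self: "cvec_inner u u = of_real ((norm u)\<^sup>2)"
  by (simp add: cvec_inner_def norm_vec_def L2_set_def sum_nonneg complex_norm_square mult.commute
      del: of_real_power)

lemma cnj_cvec_inner: "cnj (cvec_inner u v) = cvec_inner v u"
  by (simp add: cvec_inner_def mult.commute)

lemma cvec_inner_add_left: "cvec_inner (u + v) w = cvec_inner u w + cvec_inner v w"
  by (simp add: cvec_inner_def distrib_right sum.distrib)

lemma cvec_inner_add_right: "cvec_inner w (u + v) = cvec_inner w u + cvec_inner w v"
  by (simp add: cvec_inner_def distrib_left sum.distrib)

abbreviation weyl_factor :: "complex ^ 'n \<Rightarrow> complex ^ 'n \<Rightarrow> complex" where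
  "weyl_factor u v \<equiv> exp (- of_real ((norm u)\<^sup>2) / 2 - cvec_inner u v)"

lemma unitary_op_injective:
  assumes "unitary_op U" "U f = U g" shows "f = g"
proof -
  have "bounded_linear U" using assms(1) by (simp add: unitary_op_def bounded_op_def)
  then have "U (f - g) = 0"
    using assms(2) linear_diff[OF bounded_linear.linear] by fastforce
  then have "fock_inner (f - g) (f - g) = 0"
    using assms(1) unfolding unitary_op_def by (metis fock_inner_zero_left)
  then have "inner (f - g) (f - g) = 0" by (simp add: inner_fock_def)
  then show ?thesis by simp
qed

text \<open>If U f = V g, then f and g have the same inner products with all exponential vectors,
  hence coincide. This is the uniqueness behind \<open>weyl\<close>.\<close>

lemma unitary_op_eqI:
  fixes U V :: "'n::finite fock \<Rightarrow> 'n fock"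
  assumes U: "unitary_op U" and V: "unitary_op V" and eq: "\<And>v. U (exp_vec v) = V (exp_vec v)"
  shows "U = V"
proof
  fix f
  obtain g where g: "U f = V g" using V unfolding unitary_op_def surj_def by blast
  have iso: "fock_inner (U h) (U h') = fock_inner h h'" "fock_inner (V h) (V h') = fock_inner h h'" for h h'
    using U V by (simp_all add: unitary_op_def)
  have "fock_inner (exp_vec v) f = fock_inner (exp_vec v) g" for v
    using iso(1)[of "exp_vec v" f] iso(2)[of "exp_vec v" g] by (simp add: g eq)
  then have "f - g = 0" by (intro exp_vec_total) (simp add: fock_inner_diff_right)
  then show "U f = V f" using g by simp
qed

text \<open>The scalar factor is what makes the map preserve inner products: in the exponent it
  cancels the norm of u and both cross terms of the inner product of u + v and u + v'. The isometric
  extension theorem then applies.\<close>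

lemma ex_weyl:
  fixes u :: "complex ^ 'n::finite"
  shows "\<exists>W. unitary_op W \<and> (\<forall>v. W (exp_vec v) = weyl_factor u v *\<^sub>C exp_vec (u + v))"
proof -
  define a :: "complex \<times> (complex ^ 'n) \<Rightarrow> 'n fock" where "a = (\<lambda>(c, v). c *\<^sub>C exp_vec v)"
  define a' :: "complex \<times> (complex ^ 'n) \<Rightarrow> 'n fock"
    where "a' = (\<lambda>(c, v). c *\<^sub>C (weyl_factor u v *\<^sub>C exp_vec (u + v)))"
  have iso: "inner (a p) (a q) = inner (a' p) (a' q)" for p q
  proof -
    obtain c v c' v' where pq: "p = (c, v)" "q = (c', v')" by fastforce
    have "cnj (weyl_factor u v) * (weyl_factor u v' * exp (cvec_inner (u + v) (u + v'))) = exp (cvec_inner v v')"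
      by (simp add: exp_cnj cnj_cvec_inner cvec_inner_add_left cvec_inner_add_right cvec_inner_self
          flip: exp_add)
    then have "fock_inner (weyl_factor u v *\<^sub>C exp_vec (u + v)) (weyl_factor u v' *\<^sub>C exp_vec (u + v'))
        = fock_inner (exp_vec v) (exp_vec v')"
      unfolding fock_inner_scale_left fock_inner_scale_right fock_inner_exp_vec
      by (simp only: mult.left_commute)
    then show ?thesis
      by (simp add: a_def a'_def pq inner_fock_def fock_inner_scale_left[of c]
          fock_inner_scale_right[of _ c'])
  qed
  have total: "f = 0" if "\<And>i. inner f (a i) = 0" for f
    using real_total_of_complex_total[of f exp_vec] exp_vec_total[of f] that[of "(_, _)"] by (simp add: a_def)
  \<comment> \<open>Translation by u permutes the exponential vectors and the factor is nonzero, so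
    the image family contains the original one.\<close>
  have total': "f = 0" if f: "\<And>i. inner f (a' i) = 0" for f
  proof (rule total)
    fix i :: "complex \<times> (complex ^ 'n)"
    obtain c v where i: "i = (c, v)" by fastforce
    have "a i = a' (c / weyl_factor u (v - u), v - u)"
      by (simp add: a_def a'_def i fock_scale_assoc)
    then show "inner f (a i) = 0" using f by simp
  qed
  obtain W where W: "bounded_linear W" "surj W" "\<And>f g. inner (W f) (W g) = inner f g" "\<And>i. W (a i) = a' i"
    using isometric_extension[of a a', OF iso total total'] by blast
  \<comment> \<open>The extension is only real-linear by construction. Both sides agree on the
    family, which is closed under complex multiples.\<close>
  have scale: "W (c *\<^sub>C f) = c *\<^sub>C W f" for c f
  proof -
    have "(\<lambda>f. W (c *\<^sub>C f)) = (\<lambda>f. c *\<^sub>C W f)"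
    proof (rule bounded_linear_eq_on_total[of _ _ a])
      show "bounded_linear (\<lambda>f. W (c *\<^sub>C f))"
        by (rule bounded_linear_compose[OF W(1) bounded_linear_fock_scale])
      show "bounded_linear (\<lambda>f. c *\<^sub>C W f)"
        by (rule bounded_linear_compose[OF bounded_linear_fock_scale W(1)])
      show "W (c *\<^sub>C a i) = c *\<^sub>C W (a i)" for i
      proof -
        obtain d v where i: "i = (d, v)" by fastforce
        have "c *\<^sub>C a i = a (c * d, v)" by (simp add: a_def i fock_scale_assoc)
        then show ?thesis by (simp add: W(4)) (simp add: a'_def i fock_scale_assoc mult.assoc)
      qed
    qed (rule total)
    then show ?thesis by (rule fun_cong)
  qed
  have "fock_inner (W f) (W g) = fock_inner f g" for f g
  proof (rule complex_eqI)
    show "Re (fock_inner (W f) (W g)) = Re (fock_inner f g)"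
      using W(3)[of f g] by (simp add: inner_fock_def)
    show "Im (fock_inner (W f) (W g)) = Im (fock_inner f g)"
      using W(3)[of f "- \<i> *\<^sub>C g"] unfolding scale by (simp add: inner_fock_def fock_inner_scale_right)
  qed
  then have "unitary_op W" using W scale by (simp add: unitary_op_def bounded_op_def)
  moreover have "W (exp_vec v) = weyl_factor u v *\<^sub>C exp_vec (u + v)" for v
    using W(4)[of "(1, v)"] by (simp add: a_def a'_def)
  ultimately show ?thesis by blast
qed

lemma weyl:
  shows unitary_weyl: "unitary_op (weyl u)"
    and weyl_exp_vec: "weyl u (exp_vec v) = weyl_factor u v *\<^sub>C exp_vec (u + v)"
proof -
  have "\<exists>!W. unitary_op W \<and> (\<forall>v. W (exp_vec v) = weyl_factor u v *\<^sub>C exp_vec (u + v))"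
    using ex_weyl[of u]
  proof (elim exE, intro ex1I)
    fix W V :: "'a fock \<Rightarrow> 'a fock"
    assume W: "unitary_op W \<and> (\<forall>v. W (exp_vec v) = weyl_factor u v *\<^sub>C exp_vec (u + v))"
      and V: "unitary_op V \<and> (\<forall>v. V (exp_vec v) = weyl_factor u v *\<^sub>C exp_vec (u + v))"
    show "V = W" using W V by (intro unitary_op_eqI) auto
  qed
  from theI'[OF this, folded weyl_def]
  show "unitary_op (weyl u)" "weyl u (exp_vec v) = weyl_factor u v *\<^sub>C exp_vec (u + v)" by auto
qed

text \<open>Allows the trace of a state to be evaluated over the image of a basis as well.\<close>

lemma orthonormal_basis_unitary_image:
  assumes U: "unitary_op U" and B: "orthonormal_basis B"
  shows "orthonormal_basis (U ` B)"
proof -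
  have iso: "fock_inner (U h) (U h') = fock_inner h h'" for h h'
    using U by (simp add: unitary_op_def)
  have "f = 0" if f: "\<And>e. e \<in> B \<Longrightarrow> fock_inner (U e) f = 0" for f
  proof -
    obtain g where g: "f = U g" using U unfolding unitary_op_def surj_def by blast
    have "g = 0" using f by (intro orthonormal_basisD(2)[OF B]) (simp add: g iso)
    moreover have "linear U" using U by (simp add: unitary_op_def bounded_op_def bounded_linear.linear)
    ultimately show ?thesis using g by (simp add: linear_0)
  qed
  moreover have "fock_inner (U e) (U e') = (if U e = U e' then 1 else 0)" if "e \<in> B" "e' \<in> B" for e e'
    using orthonormal_basisD(1)[OF B that] unitary_op_injective[OF U, of e e'] by (auto simp: iso)
  ultimately show ?thesis unfolding orthonormal_basis_def by (intro conjI ballI allI impI) auto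
qed

text \<open>Cauchy--Schwarz for \<open>\<rho>\<close> compares the basis vectors with their images, and both families are
  orthonormal bases over which the diagonal of \<open>\<rho>\<close> sums to 1.\<close>

lemma state_partial_trace_le:
  fixes \<rho> U :: "'n::finite fock \<Rightarrow> 'n fock"
  assumes \<rho>: "state \<rho>" and U: "unitary_op U" and F: "finite F"
  shows "cmod (\<Sum>M\<in>F. fock_inner (occ_vec M) (\<rho> (U (occ_vec M)))) \<le> 1"
proof -
  have pos: "positive_op \<rho>" and tr: "has_trace \<rho> 1" using \<rho> by (simp_all add: state_def)
  have nonneg: "0 \<le> Re (fock_inner f (\<rho> f))" for f using pos by (simp add: positive_op_def)
  have diag: "(\<Sum>M\<in>F. Re (fock_inner (V (occ_vec M)) (\<rho> (V (occ_vec M))))) \<le> 1"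
    if "orthonormal_basis (range (\<lambda>M. V (occ_vec M)))" "inj (\<lambda>M. V (occ_vec M))" for V
  proof -
    have "((\<lambda>M. fock_inner (V (occ_vec M)) (\<rho> (V (occ_vec M)))) has_sum 1) UNIV"
      using has_traceD[OF tr that(1)] by (simp add: has_sum_reindex[OF that(2)] comp_def)
    then have "((\<lambda>M. Re (fock_inner (V (occ_vec M)) (\<rho> (V (occ_vec M))))) has_sum 1) UNIV"
      using has_sum_bounded_linear[OF bounded_linear_Re] by fastforce
    then show ?thesis
      using F nonneg by (intro finite_sum_le_has_sum) auto
  qed
  have UB: "orthonormal_basis (range (\<lambda>M. U (occ_vec M)))"
    using orthonormal_basis_unitary_image[OF U orthonormal_basis_occ_vec] by (simp add: image_image)
  have Uinj: "inj (\<lambda>M. U (occ_vec M))"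
    by (intro injI) (auto dest: unitary_op_injective[OF U])
  have "cmod (\<Sum>M\<in>F. fock_inner (occ_vec M) (\<rho> (U (occ_vec M)))) \<le>
      (\<Sum>M\<in>F. cmod (fock_inner (occ_vec M) (\<rho> (U (occ_vec M)))))"
    by (rule norm_sum)
  also have "\<dots> \<le> (\<Sum>M\<in>F. (Re (fock_inner (occ_vec M) (\<rho> (occ_vec M))) +
      Re (fock_inner (U (occ_vec M)) (\<rho> (U (occ_vec M))))) / 2)"
    by (rule sum_mono) (use positive_op_Cauchy_Schwarz[OF pos] in \<open>simp add: field_simps\<close>)
  also have "\<dots> = ((\<Sum>M\<in>F. Re (fock_inner (occ_vec M) (\<rho> (occ_vec M)))) +
      (\<Sum>M\<in>F. Re (fock_inner (U (occ_vec M)) (\<rho> (U (occ_vec M)))))) / 2"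
    by (simp add: sum.distrib flip: sum_divide_distrib)
  also have "\<dots> \<le> 1"
    using add_mono[OF diag[of "\<lambda>f. f", OF orthonormal_basis_occ_vec inj_occ_vec] diag[OF UB Uinj]] by simp
  finally show ?thesis .
qed

section \<open>Gaussian integrals\<close>

text \<open>Uniqueness of Haar measure by Fubini: the indicator of the unit ball is \<open>Q\<close>-invariant, which
  fixes the proportionality constant to be 1.\<close>

lemma distr_lborel_orthogonal:
  fixes Q :: "'a::euclidean_space \<Rightarrow> 'a"
  assumes Q: "orthogonal_transformation Q"
  shows "distr lborel borel Q = lborel"
proof -
  have lin: "linear Q" using Q by (rule orthogonal_transformation_linear)
  have normQ: "norm (Q x) = norm x" for x using Q by (rule orthogonal_transformation_norm)
  have Qb [measurable]: "Q \<in> borel_measurable borel"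
    using lin by (intro borel_measurable_continuous_onI linear_continuous_on linear_conv_bounded_linear[THEN iffD1])
  obtain R where R: "\<And>x. Q (R x) = x"
    using orthogonal_transformation_surj[OF Q] by (metis surjD)
  have Qadd: "Q (x + y) = Q x + Q y" for x y using lin by (rule linear_add)
  define f :: "'a \<Rightarrow> ennreal" where "f = indicator (ball 0 1)"
  have [measurable]: "f \<in> borel_measurable borel" unfolding f_def by (intro borel_measurable_indicator) simp
  have fQ: "f (Q x) = f x" for x by (simp add: f_def normQ indicator_def)
  have fpos: "(\<integral>\<^sup>+x. f x \<partial>lborel) \<noteq> 0" "(\<integral>\<^sup>+x. f x \<partial>lborel) \<noteq> \<infinity>"
    unfolding f_def using emeasure_lborel_ball_finite[of "0::'a" 1]
    by (auto simp: emeasure_lborel_ball_finite content_ball_pos emeasure_ball less_top dest: arg_cong[where f = "\<lambda>r. r > 0"])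
  have shift: "(\<integral>\<^sup>+x. h (c + x) \<partial>lborel) = (\<integral>\<^sup>+x. h x \<partial>lborel)" if [measurable]: "h \<in> borel_measurable borel" for h :: "'a \<Rightarrow> ennreal" and c
    using nn_integral_distr[of "(+) c" lborel borel h] lborel_distr_plus[of c] by simp
  have refl: "(\<integral>\<^sup>+x. h (- x) \<partial>lborel) = (\<integral>\<^sup>+x. h x \<partial>lborel)" if [measurable]: "h \<in> borel_measurable borel" for h :: "'a \<Rightarrow> ennreal"
    using nn_integral_distr[of uminus lborel borel h] lborel_affine[of "-1::real" "0::'a"] by (simp add: density_1)
  have main: "(\<integral>\<^sup>+x. g (Q x) \<partial>lborel) = (\<integral>\<^sup>+x. g x \<partial>lborel)" if [measurable]: "g \<in> borel_measurable borel" for g :: "'a \<Rightarrow> ennreal"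
  proof -
    \<comment> \<open>Invariance of f makes every occurrence of x pass through Q, so that
      translating y by Q x is compatible with the later translation of x.\<close>
    have "(\<integral>\<^sup>+x. f x \<partial>lborel) * (\<integral>\<^sup>+x. g x \<partial>lborel) = (\<integral>\<^sup>+x. f (Q x) * (\<integral>\<^sup>+y. g y \<partial>lborel) \<partial>lborel)"
      by (simp add: fQ nn_integral_multc)
    also have "\<dots> = (\<integral>\<^sup>+x. (\<integral>\<^sup>+y. f (Q x) * g (Q x + y) \<partial>lborel) \<partial>lborel)"
      by (intro nn_integral_cong) (simp add: nn_integral_cmult shift)
    also have "\<dots> = (\<integral>\<^sup>+y. (\<integral>\<^sup>+x. f (Q x) * g (Q x + y) \<partial>lborel) \<partial>lborel)"
      by (rule lborel_pair.Fubini'[symmetric]) measurable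
    \<comment> \<open>Translating x by a Q-preimage of y moves the shift from the argument of g to
      that of f, where integration over y removes it.\<close>
    also have "\<dots> = (\<integral>\<^sup>+y. (\<integral>\<^sup>+x. f (Q x - y) * g (Q x) \<partial>lborel) \<partial>lborel)"
    proof (rule nn_integral_cong)
      fix y
      show "(\<integral>\<^sup>+x. f (Q x) * g (Q x + y) \<partial>lborel) = (\<integral>\<^sup>+x. f (Q x - y) * g (Q x) \<partial>lborel)"
        using shift[of "\<lambda>x. f (Q x - y) * g (Q x)" "R y"] by (simp add: Qadd R add.commute)
    qed
    also have "\<dots> = (\<integral>\<^sup>+x. (\<integral>\<^sup>+y. f (Q x - y) * g (Q x) \<partial>lborel) \<partial>lborel)"
      by (rule lborel_pair.Fubini') measurable
    also have "\<dots> = (\<integral>\<^sup>+x. (\<integral>\<^sup>+y. f y \<partial>lborel) * g (Q x) \<partial>lborel)"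
    proof (rule nn_integral_cong)
      fix x
      have "(\<integral>\<^sup>+y. f (Q x - y) \<partial>lborel) = (\<integral>\<^sup>+y. f y \<partial>lborel)"
        using refl[of "\<lambda>y. f (Q x + y)"] shift[of f "Q x"] by simp
      then show "(\<integral>\<^sup>+y. f (Q x - y) * g (Q x) \<partial>lborel) = (\<integral>\<^sup>+y. f y \<partial>lborel) * g (Q x)"
        by (simp add: nn_integral_multc)
    qed
    also have "\<dots> = (\<integral>\<^sup>+x. f x \<partial>lborel) * (\<integral>\<^sup>+x. g (Q x) \<partial>lborel)"
      by (simp add: nn_integral_cmult)
    finally show ?thesis using fpos by (simp add: ennreal_mult_cancel_left)
  qed
  show ?thesis
  proof (rule measure_eqI)
    fix A assume "A \<in> sets (distr lborel borel Q)"
    then have [measurable]: "A \<in> sets borel" by simp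
    have "emeasure (distr lborel borel Q) A = (\<integral>\<^sup>+x. indicator A x \<partial>distr lborel borel Q)" by simp
    also have "\<dots> = (\<integral>\<^sup>+x. indicator A (Q x) \<partial>lborel)" by (subst nn_integral_distr) auto
    also have "\<dots> = emeasure lborel A" by (subst main) auto
    finally show "emeasure (distr lborel borel Q) A = emeasure lborel A" .
  qed simp
qed

text \<open>Only the real part of c is absorbed by completing the square, through s \<mapsto> q s -
  r. The imaginary part becomes the frequency \<theta> of the characteristic function of the
  standard normal law, so no contour shift is needed.\<close>

lemma gaussian_integral_real_line:
  fixes t :: real and c :: complex
  assumes t: "0 < t"
  shows "has_bochner_integral lborel (\<lambda>s. exp (- of_real (t * s\<^sup>2) + c * of_real s))
      (of_real (sqrt (pi / t)) * exp (c\<^sup>2 / of_real (4 * t)))"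
proof -
  define q where "q = sqrt (2 * t)"
  have q: "q > 0" "q\<^sup>2 = 2 * t" using t by (simp_all add: q_def)
  define r where "r = Re c / q"
  define \<theta> where "\<theta> = Im c / q"
  define f where "f x = std_normal_density x *\<^sub>R iexp (\<theta> * x)" for x
  have [measurable]: "f \<in> borel_measurable borel" unfolding f_def[abs_def] by measurable
  have "integrable lborel f"
  proof (rule Bochner_Integration.integrable_bound)
    show "integrable lborel std_normal_density" using integrable_std_normal_moment[of 0] by simp
  qed (auto simp: f_def)
  moreover have "(\<integral>x. f x \<partial>lborel) = complex_of_real (exp (- (\<theta>\<^sup>2) / 2))"
    using fun_cong[OF char_std_normal_distribution, of \<theta>]
    unfolding char_def f_def by (subst (asm) integral_density) auto
  moreover have "complex_of_real (exp (- (\<theta>\<^sup>2) / 2)) = exp (- (of_real \<theta>)\<^sup>2 / 2)"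
    by (simp flip: exp_of_real)
  ultimately have int: "integrable lborel f" and val: "(\<integral>x. f x \<partial>lborel) = exp (- (of_real \<theta>)\<^sup>2 / 2)"
    by simp_all
  have "exp (- (complex_of_real \<theta>)\<^sup>2 / 2) = q *\<^sub>R (\<integral>s. f (- r + q * s) \<partial>lborel)"
    unfolding val[symmetric] using q lborel_integral_real_affine[of q f "- r"] by simp
  then have "(\<integral>s. f (- r + q * s) \<partial>lborel) = exp (- (of_real \<theta>)\<^sup>2 / 2) /\<^sub>R q"
    using q(1) by simp
  then have affine: "has_bochner_integral lborel (\<lambda>s. f (- r + q * s)) (exp (- (of_real \<theta>)\<^sup>2 / 2) /\<^sub>R q)"
    using q lborel_integrable_real_affine[OF int, of q "- r"] by (simp only: has_bochner_integral_iff)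
  have f: "f (- r + q * s) = exp (- of_real (t * s\<^sup>2) + c * of_real s) *
      (exp (- (of_real (r\<^sup>2) + 2 * \<i> * of_real (r * \<theta>)) / 2) / of_real (sqrt (2 * pi)))" for s
  proof -
    have "- ((- r + q * s)\<^sup>2) / 2 = - t * s\<^sup>2 + Re c * s - r\<^sup>2 / 2"
    proof -
      have "(- r + q * s)\<^sup>2 = r\<^sup>2 - 2 * (q * r) * s + q\<^sup>2 * s\<^sup>2"
        by (simp add: power2_eq_square algebra_simps)
      moreover have "q * r = Re c" using q(1) by (simp add: r_def)
      ultimately show ?thesis unfolding q(2) by (simp add: field_simps)
    qed
    moreover have "\<theta> * (- r + q * s) = Im c * s - r * \<theta>"
      using q by (simp add: \<theta>_def field_simps)
    ultimately have "f (- r + q * s) = exp (of_real (- t * s\<^sup>2 + Re c * s - r\<^sup>2 / 2)) * iexp (Im c * s - r * \<theta>)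
        / of_real (sqrt (2 * pi))"
      unfolding f_def std_normal_density_def
      by (simp only: scaleR_conv_of_real exp_of_real of_real_mult of_real_divide of_real_1)
         (simp only: divide_inverse mult_ac mult_1_left)
    also have "\<dots> = exp (of_real (- t * s\<^sup>2 + Re c * s - r\<^sup>2 / 2) + \<i> * of_real (Im c * s - r * \<theta>))
        / of_real (sqrt (2 * pi))"
      by (simp add: exp_add)
    also have "of_real (- t * s\<^sup>2 + Re c * s - r\<^sup>2 / 2) + \<i> * of_real (Im c * s - r * \<theta>) =
        (- of_real (t * s\<^sup>2) + c * of_real s) + (- (of_real (r\<^sup>2) + 2 * \<i> * of_real (r * \<theta>)) / 2)"
      by (simp add: complex_eq_iff field_simps)
    finally show ?thesis by (simp add: exp_add)
  qed
  have cancel: "exp (- X / 2) / k * (exp (X / 2) * k) = 1" if "k \<noteq> 0" for X k :: complex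
    using that by (simp add: exp_minus)
  have "has_bochner_integral lborel
      (\<lambda>s. f (- r + q * s) * (exp ((of_real (r\<^sup>2) + 2 * \<i> * of_real (r * \<theta>)) / 2) * of_real (sqrt (2 * pi))))
      ((exp (- (of_real \<theta>)\<^sup>2 / 2) /\<^sub>R q) * (exp ((of_real (r\<^sup>2) + 2 * \<i> * of_real (r * \<theta>)) / 2) * of_real (sqrt (2 * pi))))"
    using affine by (rule has_bochner_integral_mult_left)
  moreover have "f (- r + q * s) * (exp ((of_real (r\<^sup>2) + 2 * \<i> * of_real (r * \<theta>)) / 2) * of_real (sqrt (2 * pi))) =
      exp (- of_real (t * s\<^sup>2) + c * of_real s)" for s
    unfolding f mult.assoc by (subst cancel) simp_all
  moreover have "(exp (- (of_real \<theta>)\<^sup>2 / 2) /\<^sub>R q) * (exp ((of_real (r\<^sup>2) + 2 * \<i> * of_real (r * \<theta>)) / 2) * of_real (sqrt (2 * pi)))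
      = of_real (sqrt (pi / t)) * exp (c\<^sup>2 / of_real (4 * t))"
  proof -
    have "sqrt (2 * pi) / q = sqrt (pi / t)"
      using t by (simp add: q_def real_sqrt_divide real_sqrt_mult)
    then have sq: "complex_of_real (sqrt (2 * pi)) / of_real q = of_real (sqrt (pi / t))"
      by (simp flip: of_real_divide)
    have qq: "complex_of_real q * complex_of_real q = of_real (2 * t)"
      using q(2) by (simp add: power2_eq_square flip: of_real_mult)
    have "c = of_real (q * r) + \<i> * of_real (q * \<theta>)"
      using q by (simp add: r_def \<theta>_def complex_eq_iff)
    then have "c\<^sup>2 = of_real q * of_real q * (of_real r + \<i> * of_real \<theta>)\<^sup>2"
      by (simp add: power2_eq_square algebra_simps)
    then have "c\<^sup>2 / of_real (4 * t) = (of_real r + \<i> * of_real \<theta>)\<^sup>2 / 2"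
      using t unfolding qq by (simp add: field_simps)
    also have "\<dots> = - (of_real \<theta>)\<^sup>2 / 2 + (of_real (r\<^sup>2) + 2 * \<i> * of_real (r * \<theta>)) / 2"
      by (simp add: power2_eq_square field_simps)
    finally have ex: "exp (c\<^sup>2 / of_real (4 * t)) = exp (- (of_real \<theta>)\<^sup>2 / 2) * exp ((of_real (r\<^sup>2) + 2 * \<i> * of_real (r * \<theta>)) / 2)"
      by (simp only: exp_add)
    show ?thesis
      unfolding ex sq[symmetric] by (simp add: scaleR_conv_of_real field_simps)
  qed
  ultimately show ?thesis by simp
qed

text \<open>\<open>lborel\<close> is the image of a product measure indexed by basis vectors;
  \<open>idx\<close> translates these back to coordinates, and the product rule for integrals
  applies.\<close>

lemma has_bochner_integral_vec_prod:
  fixes g :: "'m::finite \<Rightarrow> real \<Rightarrow> complex"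
  assumes "\<And>k. has_bochner_integral lborel (g k) (I k)"
  shows "has_bochner_integral lborel (\<lambda>v :: real ^ 'm. \<Prod>k\<in>UNIV. g k (v $ k)) (\<Prod>k\<in>UNIV. I k)"
proof -
  interpret product_sigma_finite "\<lambda>_ :: real ^ 'm. lborel :: real measure" by standard
  define idx :: "real ^ 'm \<Rightarrow> 'm" where "idx = inv (\<lambda>k. axis k 1)"
  have inj: "inj (\<lambda>k :: 'm. axis k (1 :: real))" by (auto simp: inj_def axis_eq_axis)
  have idx: "idx (axis k 1) = k" for k unfolding idx_def by (rule inv_f_f[OF inj])
  have Basis: "(Basis :: (real ^ 'm) set) = range (\<lambda>k. axis k 1)"
    by (auto simp: Basis_vec_def)
  have prod: "(\<Prod>k\<in>UNIV. h k) = (\<Prod>b\<in>Basis. h (idx b))" for h :: "'m \<Rightarrow> complex"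
    unfolding Basis by (subst prod.reindex[OF inj]) (simp add: idx)
  have int: "integrable lborel (g k)" and I: "I k = integral\<^sup>L lborel (g k)" for k
    using assms[of k] by (auto simp: has_bochner_integral_iff)
  have [measurable]: "g k \<in> borel_measurable borel" for k
    using borel_measurable_integrable[OF int[of k]] by simp
  have comp: "(\<Prod>k\<in>UNIV. g k (v $ k)) = (\<Prod>b\<in>Basis. g (idx b) (v \<bullet> b))" for v :: "real ^ 'm"
    unfolding Basis by (subst prod.reindex[OF inj]) (simp add: idx inner_axis)
  have "has_bochner_integral (\<Pi>\<^sub>M b\<in>Basis. lborel)
      (\<lambda>f. \<Prod>b\<in>(Basis :: (real ^ 'm) set). g (idx b) (f b)) (\<Prod>b\<in>Basis. I (idx b))"
    unfolding has_bochner_integral_iff I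
    using product_integrable_prod[of Basis "\<lambda>b. g (idx b)"] product_integral_prod[of Basis "\<lambda>b. g (idx b)"] int
    by simp
  then have "has_bochner_integral (\<Pi>\<^sub>M b\<in>Basis. lborel)
      (\<lambda>f. \<Prod>b\<in>(Basis :: (real ^ 'm) set). g (idx b) ((\<Sum>b\<in>Basis. f b *\<^sub>R b) \<bullet> b)) (\<Prod>b\<in>Basis. I (idx b))"
    by (simp cong: prod.cong)
  then have "has_bochner_integral (distr (\<Pi>\<^sub>M b\<in>Basis. lborel) borel (\<lambda>f. \<Sum>b\<in>Basis. f b *\<^sub>R b))
      (\<lambda>v. \<Prod>b\<in>(Basis :: (real ^ 'm) set). g (idx b) (v \<bullet> b)) (\<Prod>b\<in>Basis. I (idx b))"
    by (intro has_bochner_integral_distr) auto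
  then show ?thesis
    unfolding comp prod lborel_eq[symmetric] .
qed

lemma gaussian_integral_vec:
  fixes t :: "'m::finite \<Rightarrow> real" and c :: "'m \<Rightarrow> complex"
  assumes "\<And>k. 0 < t k"
  shows "has_bochner_integral lborel
      (\<lambda>v :: real ^ 'm. exp (\<Sum>k\<in>UNIV. - of_real (t k * (v $ k)\<^sup>2) + c k * of_real (v $ k)))
      (\<Prod>k\<in>UNIV. of_real (sqrt (pi / t k)) * exp ((c k)\<^sup>2 / of_real (4 * t k)))"
  unfolding exp_sum[OF finite]
  by (rule has_bochner_integral_vec_prod) (rule gaussian_integral_real_line[OF assms])

text \<open>The vectors for which the formula holds form a subspace, closed by dominated convergence
  with a multiple of w. Measurability in v also passes to the limit, so it is needed only on the
  total family.\<close>

lemma has_bochner_integral_on_total: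
  fixes T :: "'v \<Rightarrow> 'a::{real_inner,complete_space} \<Rightarrow> 'b::{banach,second_countable_topology}"
  assumes T: "\<And>v. bounded_linear (T v)" and bound: "\<And>v f. norm (T v f) \<le> w v * norm f"
    and w: "integrable M w" and L: "bounded_linear L"
    and a: "\<And>i. has_bochner_integral M (\<lambda>v. T v (a i)) (L (a i))"
    and total: "\<And>x. (\<And>i. inner x (a i) = 0) \<Longrightarrow> x = 0"
  shows "has_bochner_integral M (\<lambda>v. T v f) (L f)"
proof -
  let ?X = "{f. has_bochner_integral M (\<lambda>v. T v f) (L f)}"
  note lin = bounded_linear.linear[OF T] bounded_linear.linear[OF L]
  have "?X = UNIV"
  proof (rule closed_subspace_eq_UNIV)
    show "subspace ?X"
      by (rule subspaceI)
         (auto simp: linear_0[OF lin(1)] linear_0[OF lin(2)] linear_add[OF lin(1)] linear_add[OF lin(2)]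
           linear_scale[OF lin(1)] linear_scale[OF lin(2)]
           intro: has_bochner_integral_add has_bochner_integral_scaleR_right has_bochner_integral_zero)
    show "closed ?X" unfolding closed_sequential_limits
    proof (intro allI impI, elim conjE)
      fix s l assume s: "\<forall>n. s n \<in> ?X" "s \<longlonglongrightarrow> l"
      then have int: "integrable M (\<lambda>v. T v (s n))" and eq: "integral\<^sup>L M (\<lambda>v. T v (s n)) = L (s n)" for n
        by (auto simp: has_bochner_integral_iff)
      have meas: "(\<lambda>v. T v (s n)) \<in> borel_measurable M" for n
        using int by (rule borel_measurable_integrable)
      have lim: "(\<lambda>n. T v (s n)) \<longlonglongrightarrow> T v l" for v
        by (rule bounded_linear.tendsto[OF T s(2)])
      obtain K where K: "\<And>n. norm (s n) \<le> K"
        using convergent_imp_Bseq[OF convergentI[OF s(2)]] unfolding Bseq_def by blast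
      have dom: "norm (T v (s n)) \<le> norm (w v * K)" for v n
      proof -
        have "norm (T v (s n)) \<le> \<bar>w v\<bar> * norm (s n)"
          by (rule order.trans[OF bound]) (simp add: mult_right_mono)
        also have "\<dots> \<le> \<bar>w v\<bar> * \<bar>K\<bar>"
          using K[of n] by (intro mult_left_mono) auto
        finally show ?thesis by (simp add: abs_mult)
      qed
      have lim': "AE v in M. (\<lambda>n. T v (s n)) \<longlonglongrightarrow> T v l"
        and dom': "AE v in M. norm (T v (s n)) \<le> norm (w v * K)" for n
        using lim dom by simp_all
      have measl: "(\<lambda>v. T v l) \<in> borel_measurable M"
        by (rule borel_measurable_LIMSEQ_metric[OF meas lim])
      have wK: "integrable M (\<lambda>v. norm (w v * K))" using w by simp
      have "integrable M (\<lambda>v. T v l)"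
        by (rule integrable_dominated_convergence[OF measl meas wK lim' dom'])
      moreover have "(\<lambda>n. integral\<^sup>L M (\<lambda>v. T v (s n))) \<longlonglongrightarrow> integral\<^sup>L M (\<lambda>v. T v l)"
        by (rule integral_dominated_convergence[OF measl meas wK lim' dom'])
      then have "integral\<^sup>L M (\<lambda>v. T v l) = L l"
        unfolding eq using bounded_linear.tendsto[OF L s(2)] LIMSEQ_unique by blast
      ultimately show "l \<in> ?X" by (simp add: has_bochner_integral_iff)
    qed
    show "x = 0" if "\<And>y. y \<in> ?X \<Longrightarrow> inner x y = 0" for x
      using that a by (intro total) auto
  qed
  then show ?thesis by blast
qed

section \<open>The Gaussian mixture of Weyl operators\<close>

lemma norm_vec_square: "(norm v)\<^sup>2 = (\<Sum>k\<in>UNIV. (v $ k)\<^sup>2)" for v :: "real ^ 'm::finite"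
  by (simp add: norm_vec_def L2_set_def sum_nonneg)

lemma integrable_gaussian_weight:
  assumes "0 < t"
  shows "integrable lborel (\<lambda>v :: real ^ 'm::finite. norm (exp (- complex_of_real (t * (norm v)\<^sup>2))))"
proof (rule integrable_norm)
  have "integrable lborel (\<lambda>v :: real ^ 'm. exp (\<Sum>k\<in>UNIV. - complex_of_real (t * (v $ k)\<^sup>2) + 0 * complex_of_real (v $ k)))"
    using gaussian_integral_vec[of "\<lambda>_ :: 'm. t" "\<lambda>_. 0"] assms has_bochner_integral_iff by blast
  then show "integrable lborel (\<lambda>v :: real ^ 'm. exp (- complex_of_real (t * (norm v)\<^sup>2)))"
    by (simp add: norm_vec_square sum_distrib_left sum_negf)
qed

text \<open>Puts the integration over \<complex>^n on the real space where the covariance matrix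
  acts.\<close>

definition phase_vec :: "real ^ ('n + 'n) \<Rightarrow> complex ^ 'n" where
  "phase_vec v = (\<chi> i. Complex (v $ Inl i) (v $ Inr i))"

lemma sum_UNIV_Plus: "sum f (UNIV :: ('a::finite + 'b::finite) set) = (\<Sum>i\<in>UNIV. f (Inl i)) + (\<Sum>i\<in>UNIV. f (Inr i))"
  unfolding UNIV_Plus_UNIV[symmetric] by (simp add: sum.Plus del: UNIV_Plus_UNIV)

lemma norm_phase_vec: "norm (phase_vec v) = norm v"
proof -
  have "(norm (phase_vec v))\<^sup>2 = (norm v)\<^sup>2"
    unfolding norm_vec_square sum_UNIV_Plus
    by (simp add: phase_vec_def norm_vec_def L2_set_def sum_nonneg cmod_power2 sum.distrib)
  then show ?thesis by simp
qed

text \<open>On exponential vectors the integrand is a Gaussian; with \<open>\<kappa> = 1/(1-x) - 1/2\<close> the total quadratic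
  coefficient is \<open>1/(1-x)\<close>.\<close>

lemma weyl_integral_exp_vec:
  fixes u w :: "complex ^ 'n::finite" and x :: real
  assumes x: "0 \<le> x" "x < 1"
  shows "has_bochner_integral lborel
     (\<lambda>v. exp (- of_real ((1 / (1 - x) - 1/2) * (norm v)\<^sup>2)) * fock_inner (exp_vec w) (weyl (phase_vec v) (exp_vec u)))
     (of_real ((pi * (1 - x)) ^ CARD('n)) * fock_inner (exp_vec w) (number_power x (exp_vec u)))"
proof -
  \<comment> \<open>Coefficients of the real and imaginary coordinates of z in the exponent
    \<langle>w, z\<rangle> - \<langle>z, u\<rangle>.\<close>
  define c :: "'n + 'n \<Rightarrow> complex" where
    "c k = (case k of Inl i \<Rightarrow> cnj (w $ i) - u $ i | Inr i \<Rightarrow> \<i> * (cnj (w $ i) + u $ i))" for k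
  have x1: "\<bar>x\<bar> \<le> 1" using x by simp
  have "has_bochner_integral lborel
      (\<lambda>v :: real ^ ('n + 'n). exp (\<Sum>k\<in>UNIV. - of_real (1 / (1 - x) * (v $ k)\<^sup>2) + c k * of_real (v $ k)))
      (\<Prod>k\<in>UNIV. of_real (sqrt (pi / (1 / (1 - x)))) * exp ((c k)\<^sup>2 / of_real (4 * (1 / (1 - x)))))"
    using x by (intro gaussian_integral_vec) simp
  from has_bochner_integral_mult_right[OF this, of "exp (cvec_inner w u)"]
  have "has_bochner_integral lborel
      (\<lambda>v :: real ^ ('n + 'n). exp (cvec_inner w u) * exp (\<Sum>k\<in>UNIV. - of_real (1 / (1 - x) * (v $ k)\<^sup>2) + c k * of_real (v $ k)))
      (exp (cvec_inner w u) * (\<Prod>k\<in>UNIV. of_real (sqrt (pi / (1 / (1 - x)))) * exp ((c k)\<^sup>2 / of_real (4 * (1 / (1 - x))))))" .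
  moreover have "exp (cvec_inner w u) * exp (\<Sum>k\<in>UNIV. - of_real (1 / (1 - x) * (v $ k)\<^sup>2) + c k * of_real (v $ k)) =
      exp (- of_real ((1 / (1 - x) - 1/2) * (norm v)\<^sup>2)) * fock_inner (exp_vec w) (weyl (phase_vec v) (exp_vec u))" for v
  proof -
    have lin: "(\<Sum>k\<in>UNIV. c k * of_real (v $ k)) = cvec_inner w (phase_vec v) - cvec_inner (phase_vec v) u"
      unfolding sum_UNIV_Plus cvec_inner_def
      by (simp add: c_def phase_vec_def Complex_eq algebra_simps flip: sum.distrib sum_subtractf)
    have quad: "(\<Sum>k\<in>UNIV. - of_real (1 / (1 - x) * (v $ k)\<^sup>2)) =
        - of_real ((1 / (1 - x) - 1/2) * (norm v)\<^sup>2) - complex_of_real ((norm v)\<^sup>2) / 2"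
      unfolding norm_vec_square of_real_mult sum_negf sum_distrib_left[symmetric] of_real_sum[symmetric]
      by (simp add: algebra_simps)
    show ?thesis
      unfolding weyl_exp_vec fock_inner_scale_right fock_inner_exp_vec norm_phase_vec sum.distrib lin quad
      by (simp add: cvec_inner_add_right algebra_simps flip: exp_add)
  qed
  moreover have "exp (cvec_inner w u) * (\<Prod>k\<in>UNIV. of_real (sqrt (pi / (1 / (1 - x)))) * exp ((c k)\<^sup>2 / of_real (4 * (1 / (1 - x))))) =
      of_real ((pi * (1 - x)) ^ CARD('n)) * fock_inner (exp_vec w) (number_power x (exp_vec u))"
  proof -
    have "(\<Prod>k\<in>(UNIV :: ('n + 'n) set). complex_of_real (sqrt (pi / (1 / (1 - x))))) = of_real ((pi * (1 - x)) ^ CARD('n))"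
      using x by (simp add: power_add flip: of_real_power power_mult_distrib of_real_mult)
    \<comment> \<open>Per mode the two squares add up to -4 times the summand of \<langle>w,
      u\<rangle>: the squares of w and u cancel. With the prefactor, 1 - (1 - x) = x
      remains.\<close>
    moreover have "(\<Sum>k\<in>UNIV. (c k)\<^sup>2 / of_real (4 * (1 / (1 - x)))) = - of_real (1 - x) * cvec_inner w u"
      unfolding sum_UNIV_Plus cvec_inner_def sum_distrib_left sum.distrib[symmetric]
      using x by (intro sum.cong refl) (simp add: c_def power2_eq_square field_simps)
    moreover have "cvec_inner w u + - of_real (1 - x) * cvec_inner w u = cvec_inner w (\<chi> i. of_real x * u $ i)"
    proof -
      have "cvec_inner w (\<chi> i. of_real x * u $ i) = of_real x * cvec_inner w u"
        by (simp add: cvec_inner_def sum_distrib_left mult.left_commute)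
      then show ?thesis by (simp add: algebra_simps)
    qed
    ultimately show ?thesis
      unfolding number_power_exp_vec[OF x1] fock_inner_exp_vec prod.distrib exp_sum[OF finite, symmetric]
      by (simp add: exp_add[symmetric] mult.left_commute)
  qed
  ultimately show ?thesis by simp
qed

text \<open>Density is used once for each vector, the left one first. The dependence on f is
  conjugate-linear, but real linearity suffices. Unitarity of \<open>weyl\<close> bounds the
  integrand by the weight uniformly in v.\<close>

lemma weyl_integral:
  fixes f g :: "'n::finite fock" and x :: real
  assumes x: "0 \<le> x" "x < 1"
  shows "has_bochner_integral lborel
     (\<lambda>v. exp (- of_real ((1 / (1 - x) - 1/2) * (norm v)\<^sup>2)) * fock_inner f (weyl (phase_vec v) g))
     (of_real ((pi * (1 - x)) ^ CARD('n)) * fock_inner f (number_power x g))"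
    (is "has_bochner_integral lborel (\<lambda>v. ?G v * _) (?C * _)")
proof -
  define a :: "complex \<times> (complex ^ 'n) \<Rightarrow> 'n fock" where "a = (\<lambda>(c, u). c *\<^sub>C exp_vec u)"
  have total: "h = 0" if "\<And>i. inner h (a i) = 0" for h
    using real_total_of_complex_total[of h exp_vec] exp_vec_total[of h] that[of "(_, _)"] by (simp add: a_def)
  have x1: "\<bar>x\<bar> \<le> 1" using x by simp
  have W: "bounded_linear (weyl u)" "weyl u (c *\<^sub>C h) = c *\<^sub>C weyl u h" "norm (weyl u h) = norm h"
    for u :: "complex ^ 'n" and c h
    using unitary_weyl[of u] by (auto simp: unitary_op_def bounded_op_def norm_eq_sqrt_inner inner_fock_def)
  have N: "bounded_linear (number_power x :: 'n fock \<Rightarrow> _)" "number_power x (c *\<^sub>C h) = c *\<^sub>C number_power x h"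
    for c and h :: "'n fock"
    using bounded_op_number_power[OF x1] by (auto simp: bounded_op_def)
  have G: "integrable lborel (\<lambda>v :: real ^ ('n + 'n). norm (?G v))"
    using x by (intro integrable_gaussian_weight) (simp add: field_simps)
  have left: "has_bochner_integral lborel (\<lambda>v. ?G v * fock_inner f (weyl (phase_vec v) (exp_vec u)))
     (?C * fock_inner f (number_power x (exp_vec u)))" for u :: "complex ^ 'n" and f
  proof (rule has_bochner_integral_on_total[where a = a and f = f and T = "\<lambda>v f. ?G v * fock_inner f (weyl (phase_vec v) (exp_vec u))"
        and L = "\<lambda>f. ?C * fock_inner f (number_power x (exp_vec u))"])
    show "bounded_linear (\<lambda>f. ?G v * fock_inner f (weyl (phase_vec v) (exp_vec u)))" for v
      by (rule bounded_linear_compose[OF bounded_linear_mult_right bounded_linear_fock_inner_left])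
    show "bounded_linear (\<lambda>f. ?C * fock_inner f (number_power x (exp_vec u)))"
      by (rule bounded_linear_compose[OF bounded_linear_mult_right bounded_linear_fock_inner_left])
    show "norm (?G v * fock_inner f (weyl (phase_vec v) (exp_vec u))) \<le> (norm (?G v) * norm (exp_vec u)) * norm f" for v f
      using cmod_fock_inner_le[of f "weyl (phase_vec v) (exp_vec u)"]
      unfolding norm_mult W(3) mult.assoc mult.commute[of "norm (exp_vec u)"] by (intro mult_left_mono) auto
    show "integrable lborel (\<lambda>v :: real ^ ('n + 'n). norm (?G v) * norm (exp_vec u))"
      using G by (rule integrable_mult_left)
    show "has_bochner_integral lborel (\<lambda>v. ?G v * fock_inner (a i) (weyl (phase_vec v) (exp_vec u)))
       (?C * fock_inner (a i) (number_power x (exp_vec u)))" for i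
    proof -
      obtain c w where i: "i = (c, w)" by fastforce
      show ?thesis
        using has_bochner_integral_mult_right[OF weyl_integral_exp_vec[OF x, of w u], of "cnj c"]
        by (simp add: a_def i fock_inner_scale_left mult.left_commute)
    qed
  qed (rule total)
  show ?thesis
  proof (rule has_bochner_integral_on_total[where a = a and f = g and T = "\<lambda>v g. ?G v * fock_inner f (weyl (phase_vec v) g)"
        and L = "\<lambda>g. ?C * fock_inner f (number_power x g)"])
    show "bounded_linear (\<lambda>g. ?G v * fock_inner f (weyl (phase_vec v) g))" for v
      by (rule bounded_linear_compose[OF bounded_linear_mult_right
          bounded_linear_compose[OF bounded_linear_fock_inner_right W(1)]])
    show "bounded_linear (\<lambda>g. ?C * fock_inner f (number_power x g))"
      by (rule bounded_linear_compose[OF bounded_linear_mult_right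
          bounded_linear_compose[OF bounded_linear_fock_inner_right N(1)]])
    show "norm (?G v * fock_inner f (weyl (phase_vec v) g)) \<le> (norm (?G v) * norm f) * norm g" for v g
      using cmod_fock_inner_le[of f "weyl (phase_vec v) g"]
      unfolding norm_mult W(3) mult.assoc by (intro mult_left_mono) auto
    show "integrable lborel (\<lambda>v :: real ^ ('n + 'n). norm (?G v) * norm f)"
      using G by (rule integrable_mult_left)
    show "has_bochner_integral lborel (\<lambda>v. ?G v * fock_inner f (weyl (phase_vec v) (a i)))
       (?C * fock_inner f (number_power x (a i)))" for i
    proof -
      obtain c u where i: "i = (c, u)" by fastforce
      show ?thesis
        using has_bochner_integral_mult_right[OF left[of f u], of c]
        by (simp add: a_def i W(2) N(2) fock_inner_scale_right mult.left_commute)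
    qed
  qed (rule total)
qed

text \<open>The Weyl operator series for \<open>Tr \<rho> W\<close> has partial sums bounded by 1, so it may be integrated
  termwise against the Gaussian weight.\<close>

lemma number_pgf_sums_weyl_integral:
  fixes \<rho> :: "'n::finite fock \<Rightarrow> 'n fock"
  assumes \<rho>: "state \<rho>" and x: "0 \<le> x" "x < 1"
    and T: "\<And>v. has_trace (\<rho> \<circ> weyl (phase_vec v)) (T v)"
    and I: "has_bochner_integral lborel (\<lambda>v. exp (- of_real ((1 / (1 - x) - 1/2) * (norm v)\<^sup>2)) * T v) I"
  shows "(\<lambda>k. complex_of_real (number_prob \<rho> k * x ^ k)) sums (I / of_real ((pi * (1 - x)) ^ CARD('n)))"
proof -
  let ?G = "\<lambda>v :: real ^ ('n + 'n). exp (- complex_of_real ((1 / (1 - x) - 1/2) * (norm v)\<^sup>2))"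
  let ?C = "complex_of_real ((pi * (1 - x)) ^ CARD('n))"
  let ?d = "\<lambda>v M. fock_inner (occ_vec M) (\<rho> (weyl (phase_vec v) (occ_vec M)))"
  have C: "?C \<noteq> 0" using x by simp
  have x1: "\<bar>x\<bar> \<le> 1" using x by simp
  have pos: "positive_op \<rho>" using \<rho> by (simp add: state_def)
  \<comment> \<open>Self-adjointness puts \<open>\<rho>\<close> on the left vector, and the right
    vector is an eigenvector of x^N.\<close>
  have termwise: "has_bochner_integral lborel (\<lambda>v. ?G v * ?d v M)
      (?C * (of_real x ^ size M * fock_inner (occ_vec M) (\<rho> (occ_vec M))))" for M
    using weyl_integral[OF x, of "\<rho> (occ_vec M)" "occ_vec M"]
    by (simp add: positive_op_symmetric[OF pos] number_power_occ_vec[OF x1] fock_inner_scale_right)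
  have fin: "finite {M :: 'n multiset. size M = r}" for r by (rule finite_multisets_of_size)
  have partial: "has_bochner_integral lborel (\<lambda>v. ?G v * (\<Sum>r<K. \<Sum>M | size M = r. ?d v M))
      (\<Sum>r<K. ?C * complex_of_real (number_prob \<rho> r * x ^ r))" for K
  proof -
    have "?C * complex_of_real (number_prob \<rho> r * x ^ r) =
        (\<Sum>M | size M = r. ?C * (of_real x ^ size M * fock_inner (occ_vec M) (\<rho> (occ_vec M))))" for r
      unfolding of_real_mult[of "number_prob \<rho> r"] number_prob_eq[OF pos] sum_distrib_right sum_distrib_left
      by (intro sum.cong refl) (auto simp: mult.commute)
    then show ?thesis
      unfolding sum_distrib_left by (simp only:) (intro has_bochner_integral_sum termwise)
  qed
  have G: "integrable lborel (\<lambda>v. norm (?G v))"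
    using x by (intro integrable_gaussian_weight) (simp add: field_simps)
  have "(\<lambda>K. integral\<^sup>L lborel (\<lambda>v. ?G v * (\<Sum>r<K. \<Sum>M | size M = r. ?d v M)))
      \<longlonglongrightarrow> integral\<^sup>L lborel (\<lambda>v. ?G v * T v)"
  proof (rule integral_dominated_convergence[where w = "\<lambda>v. norm (?G v)"])
    show "(\<lambda>v. ?G v * T v) \<in> borel_measurable lborel"
      using I by (rule borel_measurable_has_bochner_integral)
    show "(\<lambda>v. ?G v * (\<Sum>r<K. \<Sum>M | size M = r. ?d v M)) \<in> borel_measurable lborel" for K
      using partial by (rule borel_measurable_has_bochner_integral)
    have "(\<lambda>r. \<Sum>M | size M = r. ?d v M) sums T v" for v
      using has_sum_levels[OF has_trace_occ_vec[OF T] fin] by simp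
    then show "AE v in lborel. (\<lambda>K. ?G v * (\<Sum>r<K. \<Sum>M | size M = r. ?d v M)) \<longlonglongrightarrow> ?G v * T v"
      unfolding sums_def by (intro AE_I2 tendsto_mult_left)
    show "AE v in lborel. norm (?G v * (\<Sum>r<K. \<Sum>M | size M = r. ?d v M)) \<le> norm (?G v)" for K
      unfolding norm_mult sum_levels(1)[OF fin]
      by (intro AE_I2 mult_right_le_one_le state_partial_trace_le[OF \<rho> unitary_weyl] sum_levels(2)[OF fin]) auto
  qed (rule G)
  then have "(\<lambda>r. ?C * complex_of_real (number_prob \<rho> r * x ^ r)) sums I"
    using partial I by (simp add: has_bochner_integral_iff sums_def)
  from sums_divide[OF this, of ?C] show ?thesis using C by simp
qed

section \<open>The covariance matrix and its eigenbasis\<close>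

lemma eigenvalue_nonneg:
  fixes S :: "real ^ ('n::finite + 'n) ^ ('n + 'n)"
  assumes psd: "psd_mat (\<chi> i j. complex_of_real (2 * S $ i $ j) + \<i> * complex_of_real (J_mat $ i $ j))"
    and eigen: "S *v b = r *\<^sub>R b" and norm: "b \<bullet> b = 1"
  shows "0 \<le> r"
proof -
  let ?M = "\<chi> i j. complex_of_real (2 * S $ i $ j) + \<i> * complex_of_real (J_mat $ i $ j)"
  let ?z = "\<chi> i. complex_of_real (b $ i)"
  \<comment> \<open>On a real vector the term with \<open>J_mat\<close> contributes only to the
    imaginary part.\<close>
  have "Re (cvec_inner ?z (?M *v ?z)) = 2 * (b \<bullet> (S *v b))"
    by (simp add: cvec_inner_def matrix_vector_mult_def inner_vec_def sum_distrib_left algebra_simps)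
  also have "\<dots> = 2 * r" by (simp add: eigen norm)
  finally have "Re (cvec_inner ?z (?M *v ?z)) = 2 * r" .
  moreover have "0 \<le> Re (cvec_inner ?z (?M *v ?z))"
    using spec[OF psd[unfolded psd_mat_def], of ?z] by (rule conjunct2)
  ultimately show ?thesis by linarith
qed

lemma orthogonal_transformation_of_orthonormal:
  fixes e :: "'m::finite \<Rightarrow> real ^ 'm"
  assumes "\<And>j k. e j \<bullet> e k = (if j = k then 1 else 0)"
  shows "orthogonal_transformation (\<lambda>s :: real ^ 'm. \<Sum>k\<in>UNIV. s $ k *\<^sub>R e k)"
  unfolding orthogonal_transformation_def
proof (intro conjI allI)
  show "linear (\<lambda>s :: real ^ 'm. \<Sum>k\<in>UNIV. s $ k *\<^sub>R e k)"
    by (rule linearI) (simp_all add: scaleR_left_distrib sum.distrib scaleR_sum_right)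
  show "(\<Sum>k\<in>UNIV. v $ k *\<^sub>R e k) \<bullet> (\<Sum>k\<in>UNIV. w $ k *\<^sub>R e k) = v \<bullet> w" for v w :: "real ^ 'm"
    by (simp only: inner_sum_left inner_sum_right inner_scaleR_left inner_scaleR_right assms)
       (simp add: inner_vec_def if_distrib mult.commute cong: if_cong)
qed

text \<open>In eigenbasis coordinates the quadratic form is diagonal and the linear term has the
  coefficients \<open>\<tau> k\<close>; an orthogonal change of variables preserves
  \<open>lborel\<close>, so the integral factors.\<close>

lemma gaussian_integral_eigenbasis:
  fixes S :: "real ^ 'm ^ 'm::finite" and e :: "'m \<Rightarrow> real ^ 'm" and \<tau> \<mu> :: "'m \<Rightarrow> real"
  assumes orthonormal: "\<And>j k. e j \<bullet> e k = (if j = k then 1 else 0)"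
    and eigen: "\<And>k. S *v e k = \<mu> k *\<^sub>R e k" and a: "\<And>k. a \<bullet> e k = \<tau> k"
    and pos: "\<And>k. 0 < t + \<mu> k"
  shows "has_bochner_integral lborel
     (\<lambda>v. exp (- of_real (t * (norm v)\<^sup>2)) * exp (- \<i> * of_real (sqrt 2 * (a \<bullet> v)) - of_real (v \<bullet> (S *v v))))
     (of_real (\<Prod>k\<in>UNIV. sqrt (pi / (t + \<mu> k)) * exp (- (\<tau> k)\<^sup>2 / (2 * (t + \<mu> k)))))"
    (is "has_bochner_integral lborel ?F ?I")
proof -
  define Q where "Q s = (\<Sum>k\<in>UNIV. s $ k *\<^sub>R e k)" for s :: "real ^ 'm"
  have Q: "orthogonal_transformation Q"
    unfolding Q_def[abs_def] using orthonormal by (rule orthogonal_transformation_of_orthonormal)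
  have QQ: "Q v \<bullet> Q w = v \<bullet> w" for v w using Q by (simp add: orthogonal_transformation_def)
  have norm: "(norm (Q s))\<^sup>2 = (\<Sum>k\<in>UNIV. (s $ k)\<^sup>2)" for s
    using norm_vec_square[of s] QQ[of s s] by (simp add: power2_norm_eq_inner)
  have aQ: "a \<bullet> Q s = (\<Sum>k\<in>UNIV. \<tau> k * s $ k)" for s
    by (simp add: Q_def inner_sum_right a mult.commute)
  have "S *v Q s = Q (\<chi> k. \<mu> k * s $ k)" for s
    by (simp add: Q_def linear_sum[OF matrix_vector_mul_linear] matrix_vector_mult_scaleR eigen mult.commute)
  then have SQ: "Q s \<bullet> (S *v Q s) = (\<Sum>k\<in>UNIV. \<mu> k * (s $ k)\<^sup>2)" for s
    by (simp only: QQ) (simp add: inner_vec_def power2_eq_square mult_ac)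
  have F: "?F (Q s) = exp (\<Sum>k\<in>UNIV. - of_real ((t + \<mu> k) * (s $ k)\<^sup>2) + (- \<i> * of_real (sqrt 2 * \<tau> k)) * of_real (s $ k))" for s
    unfolding norm aQ SQ exp_add[symmetric]
    by (simp add: sum_distrib_left sum.distrib sum_negf sum_subtractf algebra_simps)
  have I: "?I = (\<Prod>k\<in>UNIV. of_real (sqrt (pi / (t + \<mu> k))) * exp ((- \<i> * of_real (sqrt 2 * \<tau> k))\<^sup>2 / of_real (4 * (t + \<mu> k))))"
    unfolding of_real_prod
  proof (rule prod.cong)
    fix k
    have "(- \<i> * complex_of_real (sqrt 2 * \<tau> k))\<^sup>2 = of_real (- (2 * (\<tau> k)\<^sup>2))"
      by (simp add: power_mult_distrib flip: of_real_power)
    then have "(- \<i> * complex_of_real (sqrt 2 * \<tau> k))\<^sup>2 / of_real (4 * (t + \<mu> k)) = of_real (- (2 * (\<tau> k)\<^sup>2) / (4 * (t + \<mu> k)))"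
      by (simp only: of_real_divide)
    also have "- (2 * (\<tau> k)\<^sup>2) / (4 * (t + \<mu> k)) = - (\<tau> k)\<^sup>2 / (2 * (t + \<mu> k))"
      using pos[of k] by (simp add: divide_simps)
    finally show "complex_of_real (sqrt (pi / (t + \<mu> k)) * exp (- (\<tau> k)\<^sup>2 / (2 * (t + \<mu> k)))) =
        of_real (sqrt (pi / (t + \<mu> k))) * exp ((- \<i> * of_real (sqrt 2 * \<tau> k))\<^sup>2 / of_real (4 * (t + \<mu> k)))"
      by (simp only: of_real_mult exp_of_real)
  qed simp
  have "Q \<in> borel_measurable borel"
    using orthogonal_transformation_linear[OF Q]
    by (intro borel_measurable_continuous_onI linear_continuous_on) (simp add: linear_conv_bounded_linear)
  then have Qm: "Q \<in> borel_measurable lborel" by simp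
  have "linear ((*v) S)" by (rule matrix_vector_mul_linear)
  then have "continuous_on UNIV ((*v) S)"
    by (intro linear_continuous_on) (simp add: linear_conv_bounded_linear)
  then have Fm: "?F \<in> borel_measurable borel"
    by (intro borel_measurable_continuous_onI continuous_intros)
  have "has_bochner_integral lborel (\<lambda>s. ?F (Q s)) ?I"
    unfolding F I by (rule gaussian_integral_vec[OF pos])
  then have "has_bochner_integral (distr lborel borel Q) ?F ?I"
    by (rule has_bochner_integral_distr[OF Fm Qm])
  then show ?thesis unfolding distr_lborel_orthogonal[OF Q] .
qed

theorem theorem3p1:
  fixes l m :: "real ^ 'n::finite"
    and S :: "real ^ ('n + 'n) ^ ('n + 'n)"
    and \<rho> :: "'n fock \<Rightarrow> 'n fock"
    and lam \<tau> \<alpha> :: "nat \<Rightarrow> real"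
    and b :: "nat \<Rightarrow> real ^ ('n + 'n)"
    and x :: real
  assumes gaussian: "gaussian_state l m S \<rho>"
    and eigen: "\<And>j. j \<in> {1..2 * CARD('n)} \<Longrightarrow> S *v b j = lam j *\<^sub>R b j"
    and orthonormal: "\<And>i j. i \<in> {1..2 * CARD('n)} \<Longrightarrow> j \<in> {1..2 * CARD('n)} \<Longrightarrow>
          b i \<bullet> b j = (if i = j then 1 else 0)"
    and ordered: "antimono_on {1..2 * CARD('n)} lam"
    and tau: "block_vec l (- m) = (\<Sum>j = 1..2 * CARD('n). \<tau> j *\<^sub>R b j)"
    and alpha: "\<And>j. j \<in> {1..2 * CARD('n)} \<Longrightarrow> \<alpha> j = (lam j - 1/2) / (lam j + 1/2)"
    and x: "0 \<le> x" "x < 1"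
  shows "has_trace (\<rho> \<circ> number_power x) (complex_of_real (number_pgf \<rho> x)) \<and>
         summable (\<lambda>k. number_prob \<rho> k * x ^ k) \<and>
         number_pgf \<rho> x =
           (\<Prod>j = 1..2 * CARD('n).
              sqrt ((1 - \<alpha> j) / (1 - \<alpha> j * x)) *
              exp (- (1/2) * (\<tau> j)\<^sup>2 * ((1 - x) * (1 - \<alpha> j) / (1 - \<alpha> j * x))))"
proof -
  let ?J = "{1..2 * CARD('n)}"
  let ?t = "1 / (1 - x) - 1/2"
  let ?P = "\<Prod>j\<in>?J. sqrt ((1 - \<alpha> j) / (1 - \<alpha> j * x)) *
              exp (- (1/2) * (\<tau> j)\<^sup>2 * ((1 - x) * (1 - \<alpha> j) / (1 - \<alpha> j * x)))"
  have psd: "psd_mat (\<chi> i j. complex_of_real (2 * S $ i $ j) + \<i> * complex_of_real (J_mat $ i $ j))"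
    and \<rho>: "state \<rho>"
    and tr: "\<And>x y. has_trace (\<rho> \<circ> weyl (\<chi> i. Complex (x $ i) (y $ i)))
        (exp (- \<i> * of_real (sqrt 2 * (l \<bullet> x - m \<bullet> y))
              - of_real (block_vec x y \<bullet> (S *v block_vec x y))))"
    using gaussian unfolding gaussian_state_def by blast+
  have lam: "0 \<le> lam j" if "j \<in> ?J" for j
    using eigenvalue_nonneg[OF psd eigen[OF that]] orthonormal[OF that that] by simp
  have t0: "0 < ?t" using x by (simp add: field_simps)
  have char: "has_trace (\<rho> \<circ> weyl (phase_vec v))
      (exp (- \<i> * of_real (sqrt 2 * (block_vec l (- m) \<bullet> v)) - of_real (v \<bullet> (S *v v))))" for v
  proof -
    let ?x = "\<chi> i. v $ Inl i" and ?y = "\<chi> i. v $ Inr i"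
    have v: "block_vec ?x ?y = v"
      by (simp add: block_vec_def vec_eq_iff split: sum.split)
    have "block_vec l (- m) \<bullet> v = l \<bullet> ?x - m \<bullet> ?y"
      by (simp add: inner_vec_def sum_UNIV_Plus block_vec_def sum_negf)
    then show ?thesis using tr[of ?x ?y] by (simp add: v phase_vec_def)
  qed
  \<comment> \<open>The eigenvectors are numbered by 1 to 2n, whereas the coordinates of the
    integral are indexed by \<open>'n + 'n\<close>.\<close>
  obtain \<phi> :: "'n + 'n \<Rightarrow> nat" where \<phi>: "bij_betw \<phi> UNIV ?J"
    using finite_same_card_bij[of "UNIV :: ('n + 'n) set" ?J] by auto
  have \<phi>J: "\<phi> k \<in> ?J" for k using \<phi> by (auto simp: bij_betw_def)
  have "has_bochner_integral lborel
     (\<lambda>v. exp (- of_real (?t * (norm v)\<^sup>2)) *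
        exp (- \<i> * of_real (sqrt 2 * (block_vec l (- m) \<bullet> v)) - of_real (v \<bullet> (S *v v))))
     (of_real (\<Prod>k\<in>UNIV. sqrt (pi / (?t + lam (\<phi> k))) * exp (- (\<tau> (\<phi> k))\<^sup>2 / (2 * (?t + lam (\<phi> k))))))"
  proof (rule gaussian_integral_eigenbasis[where e = "\<lambda>k. b (\<phi> k)"])
    show "b (\<phi> j) \<bullet> b (\<phi> k) = (if j = k then 1 else 0)" for j k
      using orthonormal[OF \<phi>J \<phi>J, of j k] \<phi> by (auto simp: bij_betw_def inj_eq)
    show "S *v b (\<phi> k) = lam (\<phi> k) *\<^sub>R b (\<phi> k)" for k by (rule eigen[OF \<phi>J])
    show "0 < ?t + lam (\<phi> k)" for k using t0 lam[OF \<phi>J[of k]] by linarith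
    show "block_vec l (- m) \<bullet> b (\<phi> k) = \<tau> (\<phi> k)" for k
    proof -
      have "block_vec l (- m) \<bullet> b (\<phi> k) = (\<Sum>j\<in>?J. if j = \<phi> k then \<tau> j else 0)"
        unfolding tau inner_sum_left
        by (rule sum.cong[OF refl]) (simp add: orthonormal[OF _ \<phi>J[of k]])
      then show ?thesis using \<phi>J[of k] by simp
    qed
  qed
  also have "(\<Prod>k\<in>UNIV. sqrt (pi / (?t + lam (\<phi> k))) * exp (- (\<tau> (\<phi> k))\<^sup>2 / (2 * (?t + lam (\<phi> k))))) =
      (\<Prod>j\<in>?J. sqrt (pi / (?t + lam j)) * exp (- (\<tau> j)\<^sup>2 / (2 * (?t + lam j))))"
    by (rule prod.reindex_bij_betw[OF \<phi>])
  also have "\<dots> = (\<Prod>j\<in>?J. sqrt (pi * (1 - x))) * ?P"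
    unfolding prod.distrib[symmetric]
  proof (rule prod.cong)
    fix j assume j: "j \<in> ?J"
    \<comment> \<open>D is the numerator of \<open>1 - \<alpha> j * x\<close> over
      \<open>lam j + 1/2\<close>, and also (1 - x) times the Gaussian exponent; it links the
      integral to the stated factors.\<close>
    define D where "D = 1 + (lam j - 1/2) * (1 - x)"
    have lj: "0 \<le> lam j" by (rule lam[OF j])
    have D: "D = (1 - x) * (?t + lam j)" using x by (simp add: D_def field_simps)
    then have D0: "D > 0" using x t0 lj by (simp only:) (intro mult_pos_pos; linarith)
    have one: "1 - \<alpha> j = 1 / (lam j + 1/2)" "1 - \<alpha> j * x = D / (lam j + 1/2)"
      using lj by (simp_all add: alpha[OF j] D_def field_simps)
    have ratio: "(1 - \<alpha> j) / (1 - \<alpha> j * x) = 1 / D" unfolding one using lj by simp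
    have ratio': "(1 - x) * (1 - \<alpha> j) / (1 - \<alpha> j * x) = (1 - x) / D"
      using arg_cong[OF ratio, of "(*) (1 - x)"] by simp
    define E where "E = ?t + lam j"
    have inv: "1 / E = (1 - x) / D" unfolding D E_def using x t0 lj by simp
    have r: "pi / E = pi * (1 - x) * (1 / D)" "- (\<tau> j)\<^sup>2 / (2 * E) = - (1/2) * (\<tau> j)\<^sup>2 * ((1 - x) / D)"
      using arg_cong[OF inv, of "\<lambda>z. pi * z"] arg_cong[OF inv, of "\<lambda>z. - (1/2) * (\<tau> j)\<^sup>2 * z"]
      by simp_all
    show "sqrt (pi / (?t + lam j)) * exp (- (\<tau> j)\<^sup>2 / (2 * (?t + lam j))) =
        sqrt (pi * (1 - x)) * (sqrt ((1 - \<alpha> j) / (1 - \<alpha> j * x)) *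
              exp (- (1/2) * (\<tau> j)\<^sup>2 * ((1 - x) * (1 - \<alpha> j) / (1 - \<alpha> j * x))))"
      unfolding E_def[symmetric] r ratio ratio' real_sqrt_mult[of "pi * (1 - x)"] by (simp only: mult.assoc)
  qed simp
  \<comment> \<open>The 2n square roots pair up into the normalization of the Weyl integral, which
    cancels.\<close>
  also have "(\<Prod>j\<in>?J. sqrt (pi * (1 - x))) = (pi * (1 - x)) ^ CARD('n)"
    using x by (simp add: power_mult)
  finally have "(\<lambda>k. complex_of_real (number_prob \<rho> k * x ^ k)) sums
      (of_real ((pi * (1 - x)) ^ CARD('n) * ?P) / of_real ((pi * (1 - x)) ^ CARD('n)))"
    by (rule number_pgf_sums_weyl_integral[OF \<rho> x char])
  then have sums: "(\<lambda>k. complex_of_real (number_prob \<rho> k * x ^ k)) sums of_real ?P"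
    using x by (simp only: of_real_mult) simp
  then have real: "(\<lambda>k. number_prob \<rho> k * x ^ k) sums ?P" by (simp only: sums_of_real_iff)
  then have pgf: "number_pgf \<rho> x = ?P" unfolding number_pgf_def by (rule sums_unique[symmetric])
  \<comment> \<open>Existence of the trace comes from the diagonal argument, its value from
    uniqueness of the sum of the same series.\<close>
  obtain t where t: "has_trace (\<rho> \<circ> number_power x) t"
    and "(\<lambda>k. complex_of_real (number_prob \<rho> k * x ^ k)) sums t"
    using has_trace_number_power[OF _ x] \<rho> unfolding state_def by blast
  then have "t = of_real ?P" using sums sums_unique2 by blast
  with t pgf have "has_trace (\<rho> \<circ> number_power x) (complex_of_real (number_pgf \<rho> x))" by simp
  then show ?thesis using sums_summable[OF real] pgf by blast
qed

end
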